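(* There exists a universal constant $C>0$ such that the following holds for every $n$. Let $\mu$ be a centered Borel probability measure on $\mathbb{R}^n$, and let $\alpha,\beta,\gamma,\delta>0$. Assume that $\mathrm{Cov}_1(\mu)=\frac{\alpha}{\sqrt{n}}\,\mathrm{Id}$, that $$\int_{\mathbb{R}^n}\int_{\mathbb{R}^n}\frac{(x\cdot y)^4}{|x|^3|y|^3}\,d\mu(x)\,d\mu(y)\ \le\ \frac{\beta\alpha^2}{n}\qquad\text{with}\qquad \beta\le 3+\frac{\gamma}{n},$$ and that $$\int_{\mathbb{R}^n}\int_{\mathbb{R}^n}\frac{(x\cdot y)^6}{|x|^5|y|^5}\,d\mu(x)\,d\mu(y)\ \le\ \frac{\delta\alpha^2}{n^2}.$$ Then $$\mathrm{Var}(F_\mu)\ \le\ \frac{C(1+\gamma+\delta)\alpha^2}{n^3}.$$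
   Context: $x\cdot y$ and $|x|$ denote the Euclidean inner product and norm on $\mathbb{R}^n$. A probability measure $\mu$ on $\mathbb{R}^n$ is centered if it has finite first moment and $\int x\,d\mu(x)=0$. $\mathrm{Cov}_1(\mu)$ is the $n\times n$ matrix $\int_{\mathbb{R}^n} x\otimes x\,\frac{d\mu(x)}{|x|}$, with entries $\int x_ix_j/|x|\,d\mu(x)$. Integrands such as $x_ix_j/|x|$, $(x\cdot y)^4/(|x|^3|y|^3)$ and $(x\cdot y)^6/(|x|^5|y|^5)$ are taken to be $0$ where $x=0$ or $y=0$. $S^{n-1}$ is the Euclidean unit sphere and $\sigma_{n-1}$ the uniform (rotation-invariant) probability measure on it. For a probability measure $\mu$ with finite first moment, $F_\mu:S^{n-1}\to\mathbb{R}$ is $F_\mu(\theta)=\int_{\mathbb{R}^n}(x\cdot\theta)_+\,d\mu(x)$, where $t_+=\max\{t,0\}$. $\mathrm{Var}(F_\mu)$ is the variance of $F_\mu$ with respect to $\sigma_{n-1}$. *)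

theory Defs
  imports "HOL-Probability.Probability"
begin

text \<open>
  The dimension \<open>n\<close> has to be quantified inside the theorem (the constant must not depend on it),
  so a vector of \<open>\<real>\<^sup>n\<close> is an element of \<open>{..<n} \<rightarrow>\<^sub>E UNIV\<close>, i.e. a function \<open>nat \<Rightarrow> real\<close> that is
  \<open>undefined\<close> outside \<open>{..<n}\<close>. The finite product sigma-algebra below is the Borel
  sigma-algebra of \<open>\<real>\<^sup>n\<close>.
\<close>

abbreviation borel_Rn :: "nat \<Rightarrow> (nat \<Rightarrow> real) measure" where
  "borel_Rn n \<equiv> Pi\<^sub>M {..<n} (\<lambda>_. borel)"

abbreviation lborel_Rn :: "nat \<Rightarrow> (nat \<Rightarrow> real) measure" where
  "lborel_Rn n \<equiv> Pi\<^sub>M {..<n} (\<lambda>_. lborel)"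

definition dot :: "nat \<Rightarrow> (nat \<Rightarrow> real) \<Rightarrow> (nat \<Rightarrow> real) \<Rightarrow> real" where
  "dot n x y = (\<Sum>i<n. x i * y i)"

abbreviation nrm :: "nat \<Rightarrow> (nat \<Rightarrow> real) \<Rightarrow> real" where
  "nrm n x \<equiv> L2_set x {..<n}"

definition borel_prob :: "nat \<Rightarrow> (nat \<Rightarrow> real) measure \<Rightarrow> bool" where
  "borel_prob n \<mu> \<longleftrightarrow> prob_space \<mu> \<and> sets \<mu> = sets (borel_Rn n)"

definition centered :: "nat \<Rightarrow> (nat \<Rightarrow> real) measure \<Rightarrow> bool" where
  "centered n \<mu> \<longleftrightarrow> integrable \<mu> (nrm n) \<and> (\<forall>i<n. (\<integral>x. x i \<partial>\<mu>) = 0)"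

text \<open>
  Since \<open>t / 0 = 0\<close>, the integrands here and in the theorem vanish where \<open>x = 0\<close> or \<open>y = 0\<close>.
  They are bounded by \<open>\<bar>x\<bar>\<close> resp. \<open>\<bar>x\<bar> \<bar>y\<bar>\<close>, so all integrals converge for a measure with finite
  first moment and the default value of a divergent Bochner integral plays no role.
\<close>

definition Cov1 :: "nat \<Rightarrow> (nat \<Rightarrow> real) measure \<Rightarrow> nat \<Rightarrow> nat \<Rightarrow> real" where
  "Cov1 n \<mu> i j = (\<integral>x. x i * x j / nrm n x \<partial>\<mu>)"

definition Fmu :: "nat \<Rightarrow> (nat \<Rightarrow> real) measure \<Rightarrow> (nat \<Rightarrow> real) \<Rightarrow> real" where
  "Fmu n \<mu> \<theta> = (\<integral>x. max (dot n x \<theta>) 0 \<partial>\<mu>)"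

definition unit_sphere :: "nat \<Rightarrow> (nat \<Rightarrow> real) set" where
  "unit_sphere n = {x \<in> space (borel_Rn n). nrm n x = 1}"

definition unit_ball :: "nat \<Rightarrow> (nat \<Rightarrow> real) set" where
  "unit_ball n = {x \<in> space (borel_Rn n). nrm n x \<le> 1}"

definition normalize_vec :: "nat \<Rightarrow> (nat \<Rightarrow> real) \<Rightarrow> nat \<Rightarrow> real" where
  "normalize_vec n x = (\<lambda>i\<in>{..<n}. x i / nrm n x)"

text \<open>
  The uniform probability measure on the sphere, for \<open>n \<ge> 1\<close>: the law of \<open>x / \<bar>x\<bar>\<close> for \<open>x\<close>
  uniform in the unit ball. It is a probability measure invariant under the orthogonal group,
  see \<open>prob_space_sphere_measure\<close> and \<open>sphere_measure_orthogonal\<close> below.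
\<close>

definition sphere_measure :: "nat \<Rightarrow> (nat \<Rightarrow> real) measure" where
  "sphere_measure n =
     restrict_space
       (distr (uniform_measure (lborel_Rn n) (unit_ball n)) (borel_Rn n) (normalize_vec n))
       (unit_sphere n)"

definition sphere_variance :: "nat \<Rightarrow> ((nat \<Rightarrow> real) \<Rightarrow> real) \<Rightarrow> real" where
  "sphere_variance n f =
     (\<integral>\<theta>. (f \<theta> - (\<integral>\<eta>. f \<eta> \<partial>sphere_measure n))\<^sup>2 \<partial>sphere_measure n)"


lemma sets_unit_ball [measurable]: "unit_ball n \<in> sets (borel_Rn n)"
  unfolding unit_ball_def L2_set_def by measurable

lemma sets_unit_sphere [measurable]: "unit_sphere n \<in> sets (borel_Rn n)"
  unfolding unit_sphere_def L2_set_def by measurable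

lemma sets_lborel_Rn [measurable_cong]: "sets (lborel_Rn n) = sets (borel_Rn n)"
  by (rule sets_PiM_cong) auto

lemma space_lborel_Rn: "space (lborel_Rn n) = space (borel_Rn n)"
  by (simp add: space_PiM)

lemma measurable_normalize_vec [measurable]:
  "normalize_vec n \<in> borel_Rn n \<rightarrow>\<^sub>M borel_Rn n"
  unfolding normalize_vec_def L2_set_def by (intro measurable_restrict) measurable

lemma emeasure_unit_ball:
  "emeasure (lborel_Rn n) (unit_ball n) = ennreal (unit_ball_vol (real n))"
proof -
  have "unit_ball n = {f. sqrt (\<Sum>i<n. (f i)\<^sup>2) \<le> 1} \<inter> space (lborel_Rn n)"
    by (auto simp: unit_ball_def L2_set_def space_PiM)
  then show ?thesis
    using emeasure_cball_aux[of "{..<n}" 1] by simp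
qed

lemma emeasure_unit_ball_pos: "emeasure (lborel_Rn n) (unit_ball n) \<noteq> 0"
  using less_imp_neq[OF unit_ball_vol_pos[of "real n"]] by (simp add: emeasure_unit_ball)

lemma emeasure_unit_ball_finite: "emeasure (lborel_Rn n) (unit_ball n) \<noteq> \<infinity>"
  by (simp add: emeasure_unit_ball)

lemma normalize_vec_in_sphere:
  assumes "nrm n x \<noteq> 0"
  shows "normalize_vec n x \<in> unit_sphere n"
proof -
  have "nrm n (normalize_vec n x) = L2_set (\<lambda>i. inverse (nrm n x) * x i) {..<n}"
    by (intro L2_set_cong) (auto simp: normalize_vec_def field_simps)
  also have "\<dots> = inverse (nrm n x) * nrm n x"
    by (rule L2_set_right_distrib[symmetric]) simp
  finally show ?thesis
    using assms by (simp add: unit_sphere_def normalize_vec_def space_PiM)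
qed

lemma AE_nrm_nonzero:
  assumes "n \<ge> 1"
  shows "AE x in lborel_Rn n. nrm n x \<noteq> 0"
proof -
  interpret product_sigma_finite "\<lambda>_::nat. lborel :: real measure" by standard
  have "emeasure (lborel_Rn n) (\<Pi>\<^sub>E i\<in>{..<n}. {0}) = (\<Prod>i<n. emeasure lborel {0::real})"
    by (intro emeasure_PiM) auto
  also have "\<dots> = 0" using assms by (auto simp: lessThan_empty_iff intro!: prod_zero)
  finally have "(\<Pi>\<^sub>E i\<in>{..<n}. {0::real}) \<in> null_sets (lborel_Rn n)"
    by (intro null_setsI sets_PiM_I_finite) auto
  then show ?thesis
    by (rule AE_I') (auto simp: L2_set_eq_0_iff space_PiM PiE_iff extensional_def fun_eq_iff)
qed

lemma prob_space_sphere_measure: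
  assumes "n \<ge> 1"
  shows "prob_space (sphere_measure n)"
proof -
  let ?U = "uniform_measure (lborel_Rn n) (unit_ball n)"
  let ?D = "distr ?U (borel_Rn n) (normalize_vec n)"
  have U: "prob_space ?U"
    by (intro prob_space_uniform_measure emeasure_unit_ball_pos emeasure_unit_ball_finite)
  have meas: "normalize_vec n \<in> ?U \<rightarrow>\<^sub>M borel_Rn n" by measurable
  interpret D: prob_space ?D by (rule prob_space.prob_space_distr[OF U meas])
  have "AE x in ?U. normalize_vec n x \<in> unit_sphere n"
    using AE_nrm_nonzero[OF assms]
    by (intro AE_uniform_measureI) (auto simp: sets_lborel_Rn normalize_vec_in_sphere)
  then have "AE x in ?D. x \<in> unit_sphere n"
    by (subst AE_distr_iff[OF meas]) (auto simp: unit_sphere_def L2_set_def)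
  then have "emeasure ?D (unit_sphere n) = 1"
    by (intro D.emeasure_eq_1_AE) auto
  moreover have "space ?D \<inter> unit_sphere n = unit_sphere n"
    by (auto simp: unit_sphere_def)
  ultimately show ?thesis
    by (intro prob_spaceI)
       (simp add: sphere_measure_def space_restrict_space emeasure_restrict_space Int_commute)
qed

definition orthogonal_mat :: "nat \<Rightarrow> (nat \<Rightarrow> nat \<Rightarrow> real) \<Rightarrow> bool" where
  "orthogonal_mat n U \<longleftrightarrow>
     (\<forall>i<n. \<forall>j<n. (\<Sum>k<n. U k i * U k j) = (if i = j then 1 else 0)) \<and>
     (\<forall>i<n. \<forall>j<n. (\<Sum>k<n. U i k * U j k) = (if i = j then 1 else 0))"

definition mat_app :: "nat \<Rightarrow> (nat \<Rightarrow> nat \<Rightarrow> real) \<Rightarrow> (nat \<Rightarrow> real) \<Rightarrow> nat \<Rightarrow> real" where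
  "mat_app n U x = (\<lambda>i\<in>{..<n}. \<Sum>j<n. U i j * x j)"

lemma measurable_mat_app [measurable]: "mat_app n U \<in> borel_Rn n \<rightarrow>\<^sub>M borel_Rn n"
  unfolding mat_app_def by (intro measurable_restrict) measurable

lemma orthogonal_mat_transpose: "orthogonal_mat n U \<Longrightarrow> orthogonal_mat n (\<lambda>i j. U j i)"
  by (auto simp: orthogonal_mat_def)

lemma mat_app_inverse:
  assumes "orthogonal_mat n U" "x \<in> space (borel_Rn n)"
  shows "mat_app n U (mat_app n (\<lambda>i j. U j i) x) = x"
proof
  fix i
  show "mat_app n U (mat_app n (\<lambda>i j. U j i) x) i = x i"
  proof (cases "i < n")
    case True
    have "mat_app n U (mat_app n (\<lambda>i j. U j i) x) i = (\<Sum>j<n. \<Sum>k<n. U i j * U k j * x k)"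
      using True by (simp add: mat_app_def sum_distrib_left mult.assoc)
    also have "\<dots> = (\<Sum>k<n. (\<Sum>j<n. U i j * U k j) * x k)"
      by (subst sum.swap) (simp add: sum_distrib_right)
    also have "\<dots> = (\<Sum>k<n. (if i = k then 1 else 0) * x k)"
      using assms(1) True by (intro sum.cong) (auto simp: orthogonal_mat_def)
    also have "\<dots> = x i"
      using True by (simp add: if_distrib[of "\<lambda>t. t * _"] cong: if_cong)
    finally show ?thesis .
  next
    case False
    then show ?thesis
      using assms(2) by (auto simp: mat_app_def space_PiM PiE_iff extensional_def)
  qed
qed

lemma nrm_mat_app:
  assumes "orthogonal_mat n U"
  shows "nrm n (mat_app n U x) = nrm n x"
proof -
  have "(\<Sum>i<n. (mat_app n U x i)\<^sup>2) = (\<Sum>i<n. \<Sum>j<n. \<Sum>k<n. (U i j * U i k) * (x j * x k))"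
    by (simp add: mat_app_def power2_eq_square sum_product algebra_simps)
  also have "\<dots> = (\<Sum>j<n. \<Sum>k<n. \<Sum>i<n. (U i j * U i k) * (x j * x k))"
    by (subst sum.swap) (intro sum.cong refl sum.swap)
  also have "\<dots> = (\<Sum>j<n. \<Sum>k<n. (\<Sum>i<n. U i j * U i k) * (x j * x k))"
    by (simp add: sum_distrib_right)
  also have "\<dots> = (\<Sum>j<n. \<Sum>k<n. (if j = k then 1 else 0) * (x j * x k))"
    using assms by (intro sum.cong) (auto simp: orthogonal_mat_def)
  also have "\<dots> = (\<Sum>j<n. (x j)\<^sup>2)"
    by (simp add: if_distrib[of "\<lambda>t. t * _"] power2_eq_square cong: if_cong)
  finally show ?thesis by (simp add: L2_set_def)
qed

definition vec_add :: "nat \<Rightarrow> (nat \<Rightarrow> real) \<Rightarrow> (nat \<Rightarrow> real) \<Rightarrow> nat \<Rightarrow> real" where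
  "vec_add n x y = (\<lambda>i\<in>{..<n}. x i + y i)"

definition vec_diff :: "nat \<Rightarrow> (nat \<Rightarrow> real) \<Rightarrow> (nat \<Rightarrow> real) \<Rightarrow> nat \<Rightarrow> real" where
  "vec_diff n x y = (\<lambda>i\<in>{..<n}. x i - y i)"

lemma distr_lborel_Rn_translate: "distr (lborel_Rn n) (lborel_Rn n) (vec_add n c) = lborel_Rn n"
proof -
  interpret product_sigma_finite "\<lambda>_::nat. lborel :: real measure" by standard
  have meas [measurable]: "vec_add n c \<in> lborel_Rn n \<rightarrow>\<^sub>M lborel_Rn n"
    unfolding vec_add_def by (intro measurable_restrict) measurable
  show ?thesis
  proof (rule PiM_eqI)
    fix A :: "nat \<Rightarrow> real set"
    assume A: "\<And>i. i \<in> {..<n} \<Longrightarrow> A i \<in> sets lborel"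
    have A': "(+) (c i) -` A i \<in> sets lborel" if "i < n" for i
      using measurable_sets[of "(+) (c i)" borel borel "A i"] A[of i] that by simp
    have pre: "vec_add n c -` Pi\<^sub>E {..<n} A \<inter> space (lborel_Rn n) =
        Pi\<^sub>E {..<n} (\<lambda>i. (+) (c i) -` A i)"
      by (auto simp: vec_add_def space_PiM PiE_iff)
    have "emeasure (distr (lborel_Rn n) (lborel_Rn n) (vec_add n c)) (Pi\<^sub>E {..<n} A) =
        emeasure (lborel_Rn n) (Pi\<^sub>E {..<n} (\<lambda>i. (+) (c i) -` A i))"
      using A by (subst emeasure_distr) (auto simp: pre intro!: sets_PiM_I_finite)
    also have "\<dots> = (\<Prod>i<n. emeasure lborel ((+) (c i) -` A i))"
      using A' by (intro emeasure_PiM) auto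
    also have "\<dots> = (\<Prod>i<n. emeasure lborel (A i))"
    proof (rule prod.cong)
      fix i assume i: "i \<in> {..<n}"
      have "emeasure (distr lborel borel ((+) (c i))) (A i) = emeasure lborel ((+) (c i) -` A i)"
        using A[OF i] by (subst emeasure_distr) auto
      then show "emeasure lborel ((+) (c i) -` A i) = emeasure lborel (A i)"
        by (simp add: lborel_distr_plus)
    qed simp
    finally show "emeasure (distr (lborel_Rn n) (lborel_Rn n) (vec_add n c)) (Pi\<^sub>E {..<n} A) =
        (\<Prod>i<n. emeasure lborel (A i))" .
  qed simp_all
qed

lemma nn_integral_lborel_Rn_translate:
  assumes [measurable]: "f \<in> borel_measurable (borel_Rn n)"
  shows "(\<integral>\<^sup>+x. f (vec_add n c x) \<partial>lborel_Rn n) = (\<integral>\<^sup>+x. f x \<partial>lborel_Rn n)"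
proof -
  have [measurable]: "vec_add n c \<in> lborel_Rn n \<rightarrow>\<^sub>M lborel_Rn n"
    unfolding vec_add_def by (intro measurable_restrict) measurable
  have "(\<integral>\<^sup>+x. f x \<partial>distr (lborel_Rn n) (lborel_Rn n) (vec_add n c)) =
      (\<integral>\<^sup>+x. f (vec_add n c x) \<partial>lborel_Rn n)"
    by (rule nn_integral_distr) measurable
  then show ?thesis by (simp add: distr_lborel_Rn_translate)
qed

text \<open>
  Lebesgue measure on \<open>\<real>\<^sup>n\<close> is invariant under orthogonal maps: it is translation invariant, hence
  its image is translation invariant too, so the two are proportional by Fubini, and they agree on
  the unit ball.
\<close>

lemma emeasure_lborel_Rn_orthogonal:
  assumes U: "orthogonal_mat n U" and B [measurable]: "B \<in> sets (borel_Rn n)"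
  shows "emeasure (lborel_Rn n) (mat_app n U -` B \<inter> space (lborel_Rn n)) = emeasure (lborel_Rn n) B"
proof -
  let ?L = "lborel_Rn n" and ?A = "unit_ball n" and ?V = "\<lambda>i j. U j i"
  let ?a = "emeasure ?L ?A"
  interpret product_sigma_finite "\<lambda>_::nat. lborel :: real measure" by standard
  interpret L: sigma_finite_measure ?L by (rule sigma_finite) simp
  interpret P: pair_sigma_finite ?L ?L ..
  have V: "orthogonal_mat n ?V" by (rule orthogonal_mat_transpose[OF U])
  have add_meas [measurable]: "(\<lambda>p. vec_add n (f p) (g p)) \<in> M \<rightarrow>\<^sub>M borel_Rn n"
    if [measurable]: "f \<in> M \<rightarrow>\<^sub>M borel_Rn n" "g \<in> M \<rightarrow>\<^sub>M borel_Rn n"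
    for f g and M :: "'b measure"
    unfolding vec_add_def by (intro measurable_restrict) measurable
  have diff_meas [measurable]: "(\<lambda>p. vec_diff n (f p) (g p)) \<in> M \<rightarrow>\<^sub>M borel_Rn n"
    if [measurable]: "f \<in> M \<rightarrow>\<^sub>M borel_Rn n" "g \<in> M \<rightarrow>\<^sub>M borel_Rn n"
    for f g and M :: "'b measure"
    unfolding vec_diff_def by (intro measurable_restrict) measurable
  have sp: "mat_app n W x \<in> space (borel_Rn n)" "vec_add n x y \<in> space (borel_Rn n)"
    "vec_diff n x y \<in> space (borel_Rn n)" for W x y
    by (auto simp: mat_app_def vec_add_def vec_diff_def space_PiM)
  have shift_U: "vec_add n x (mat_app n U y) = mat_app n U (vec_add n (mat_app n ?V x) y)"
    if "x \<in> space (borel_Rn n)" for x y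
  proof -
    have "vec_add n x (mat_app n U y) = vec_add n (mat_app n U (mat_app n ?V x)) (mat_app n U y)"
      using mat_app_inverse[OF U that] by simp
    also have "\<dots> = mat_app n U (vec_add n (mat_app n ?V x) y)"
      by (auto simp: vec_add_def mat_app_def sum.distrib ring_distribs fun_eq_iff)
    finally show ?thesis .
  qed
  have nrm_diff: "nrm n (vec_diff n x (mat_app n U y)) = nrm n (vec_diff n y (mat_app n ?V x))"
    if "x \<in> space (borel_Rn n)" for x y
  proof -
    have "vec_diff n x (mat_app n U y) = vec_diff n (mat_app n U (mat_app n ?V x)) (mat_app n U y)"
      using mat_app_inverse[OF U that] by simp
    also have "\<dots> = mat_app n U (vec_diff n (mat_app n ?V x) y)"
      by (auto simp: vec_diff_def mat_app_def sum_subtractf ring_distribs fun_eq_iff)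
    finally have "nrm n (vec_diff n x (mat_app n U y)) = nrm n (vec_diff n (mat_app n ?V x) y)"
      by (simp add: nrm_mat_app[OF U])
    also have "\<dots> = nrm n (vec_diff n y (mat_app n ?V x))"
      unfolding L2_set_def by (simp add: vec_diff_def power2_commute)
    finally show ?thesis .
  qed
  have add_diff: "vec_diff n (vec_add n z x) z = x" if "x \<in> space (borel_Rn n)" for x z
    using that by (auto simp: vec_add_def vec_diff_def space_PiM PiE_iff extensional_def fun_eq_iff)
  have add_comm: "vec_add n x z = vec_add n z x" for x z
    by (auto simp: vec_add_def add.commute)
  have diff_add: "vec_diff n y z = vec_add n (\<lambda>i. - z i) y" for y z
    by (auto simp: vec_add_def vec_diff_def)

  have "?a * emeasure ?L (mat_app n U -` B \<inter> space ?L) =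
      (\<integral>\<^sup>+x. indicator ?A x * (\<integral>\<^sup>+y. indicator B (mat_app n U y) \<partial>?L) \<partial>?L)"
  proof -
    have "(\<integral>\<^sup>+y. indicator B (mat_app n U y) \<partial>?L) =
        (\<integral>\<^sup>+y. indicator (mat_app n U -` B \<inter> space ?L) y \<partial>?L)"
      by (intro nn_integral_cong) (auto split: split_indicator)
    also have "\<dots> = emeasure ?L (mat_app n U -` B \<inter> space ?L)"
      by (rule nn_integral_indicator) measurable
    finally show ?thesis
      by (simp add: nn_integral_multc)
  qed
  also have "\<dots> = (\<integral>\<^sup>+x. \<integral>\<^sup>+y. indicator ?A x * indicator B (vec_add n x (mat_app n U y)) \<partial>?L \<partial>?L)"
  proof (rule nn_integral_cong)
    fix x assume "x \<in> space ?L"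
    then have x: "x \<in> space (borel_Rn n)" by (simp add: space_lborel_Rn)
    have "(\<integral>\<^sup>+y. indicator B (vec_add n x (mat_app n U y)) \<partial>?L) =
        (\<integral>\<^sup>+y. indicator B (mat_app n U (vec_add n (mat_app n ?V x) y)) \<partial>?L)"
      by (simp add: shift_U[OF x])
    also have "\<dots> = (\<integral>\<^sup>+y. indicator B (mat_app n U y) \<partial>?L)"
      by (rule nn_integral_lborel_Rn_translate) measurable
    finally show "indicator ?A x * (\<integral>\<^sup>+y. indicator B (mat_app n U y) \<partial>?L) =
        (\<integral>\<^sup>+y. indicator ?A x * indicator B (vec_add n x (mat_app n U y)) \<partial>?L)"
      using x by (subst nn_integral_cmult) (auto intro!: measurable_compose[OF _ borel_measurable_indicator])
  qed
  also have "\<dots> = (\<integral>\<^sup>+y. \<integral>\<^sup>+x. indicator ?A x * indicator B (vec_add n x (mat_app n U y)) \<partial>?L \<partial>?L)"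
    by (rule P.Fubini'[symmetric]) measurable
  also have "\<dots> = (\<integral>\<^sup>+y. \<integral>\<^sup>+x. indicator ?A (vec_diff n x (mat_app n U y)) * indicator B x \<partial>?L \<partial>?L)"
  proof (rule nn_integral_cong)
    fix y assume "y \<in> space ?L"
    let ?z = "mat_app n U y"
    have "(\<integral>\<^sup>+x. indicator ?A (vec_diff n x ?z) * indicator B x \<partial>?L) =
        (\<integral>\<^sup>+x. indicator ?A (vec_diff n (vec_add n ?z x) ?z) * indicator B (vec_add n ?z x) \<partial>?L)"
      using sp by (intro nn_integral_lborel_Rn_translate[symmetric]) measurable
    also have "\<dots> = (\<integral>\<^sup>+x. indicator ?A x * indicator B (vec_add n x ?z) \<partial>?L)"
      by (intro nn_integral_cong) (simp add: add_diff space_lborel_Rn add_comm[of _ ?z])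
    finally show "(\<integral>\<^sup>+x. indicator ?A x * indicator B (vec_add n x ?z) \<partial>?L) =
        (\<integral>\<^sup>+x. indicator ?A (vec_diff n x ?z) * indicator B x \<partial>?L)" ..
  qed
  also have "\<dots> = (\<integral>\<^sup>+x. \<integral>\<^sup>+y. indicator ?A (vec_diff n x (mat_app n U y)) * indicator B x \<partial>?L \<partial>?L)"
    by (rule P.Fubini') measurable
  also have "\<dots> = (\<integral>\<^sup>+x. ?a * indicator B x \<partial>?L)"
  proof (rule nn_integral_cong)
    fix x assume "x \<in> space ?L"
    then have x: "x \<in> space (borel_Rn n)" by (simp add: space_lborel_Rn)
    have "(\<integral>\<^sup>+y. indicator ?A (vec_diff n x (mat_app n U y)) * indicator B x \<partial>?L) =
        (\<integral>\<^sup>+y. indicator ?A (vec_diff n x (mat_app n U y)) \<partial>?L) * indicator B x"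
      using x by (intro nn_integral_multc) measurable
    also have "(\<integral>\<^sup>+y. indicator ?A (vec_diff n x (mat_app n U y)) \<partial>?L) =
        (\<integral>\<^sup>+y. indicator ?A (vec_diff n y (mat_app n ?V x)) \<partial>?L)"
      using sp by (intro nn_integral_cong) (simp add: nrm_diff[OF x] unit_ball_def indicator_def)
    also have "\<dots> = (\<integral>\<^sup>+y. indicator ?A y \<partial>?L)"
      unfolding diff_add by (rule nn_integral_lborel_Rn_translate) measurable
    also have "\<dots> = ?a"
      by (rule nn_integral_indicator) measurable
    finally show "(\<integral>\<^sup>+y. indicator ?A (vec_diff n x (mat_app n U y)) * indicator B x \<partial>?L) =
        ?a * indicator B x" .
  qed
  also have "\<dots> = ?a * emeasure ?L B"
    by (simp add: nn_integral_cmult sets_lborel_Rn)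
  finally show ?thesis
    using emeasure_unit_ball_pos emeasure_unit_ball_finite
    by (simp add: ennreal_mult_cancel_left)
qed

lemma sphere_measure_orthogonal:
  assumes U: "orthogonal_mat n U"
  shows "distr (sphere_measure n) (sphere_measure n) (mat_app n U) = sphere_measure n"
proof (rule measure_eqI)
  let ?L = "lborel_Rn n"
  let ?M = "uniform_measure ?L (unit_ball n)"
  let ?D = "distr ?M (borel_Rn n) (normalize_vec n)"
  let ?S = "unit_sphere n"
  have S: "?S \<inter> space ?D \<in> sets ?D" by (auto simp: unit_sphere_def L2_set_def)
  have into: "mat_app n U x \<in> ?S \<longleftrightarrow> x \<in> ?S" if "x \<in> space (borel_Rn n)" for x
    using that by (auto simp: unit_sphere_def nrm_mat_app[OF U]) (auto simp: mat_app_def space_PiM)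
  have meas: "mat_app n U \<in> sphere_measure n \<rightarrow>\<^sub>M sphere_measure n"
    unfolding sphere_measure_def
  proof (rule measurable_restrict_space3)
    show "mat_app n U \<in> ?D \<rightarrow>\<^sub>M ?D" by simp
    show "mat_app n U \<in> ?S \<rightarrow> ?S"
      using into by (auto simp: unit_sphere_def)
  qed
  fix A assume "A \<in> sets (distr (sphere_measure n) (sphere_measure n) (mat_app n U))"
  then have A: "A \<in> sets (sphere_measure n)" by simp
  then have AS: "A \<subseteq> ?S" and AR [measurable]: "A \<in> sets (borel_Rn n)"
    using S by (auto simp: sphere_measure_def sets_restrict_space_iff)
  let ?UA = "mat_app n U -` A \<inter> space (borel_Rn n)"
  let ?NA = "normalize_vec n -` A \<inter> space (borel_Rn n)"
  have UA: "?UA \<in> sets (borel_Rn n)" by measurable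
  have UAS: "?UA \<subseteq> ?S" using AS into by auto
  have pre: "mat_app n U -` A \<inter> space (sphere_measure n) = ?UA"
    using UAS by (auto simp: sphere_measure_def space_restrict_space unit_sphere_def)
  have comm: "normalize_vec n (mat_app n U x) = mat_app n U (normalize_vec n x)" for x
    by (auto simp: normalize_vec_def nrm_mat_app[OF U] fun_eq_iff)
       (auto simp: mat_app_def sum_divide_distrib)
  have ball: "mat_app n U x \<in> unit_ball n \<longleftrightarrow> x \<in> unit_ball n" if "x \<in> space (borel_Rn n)" for x
    using that by (auto simp: unit_ball_def nrm_mat_app[OF U]) (auto simp: mat_app_def space_PiM)
  have D: "emeasure ?D X = emeasure ?L (unit_ball n \<inter> (normalize_vec n -` X \<inter> space (borel_Rn n)))
      / emeasure ?L (unit_ball n)" if [measurable]: "X \<in> sets (borel_Rn n)" for X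
    by (subst emeasure_distr) (simp_all add: space_lborel_Rn sets_lborel_Rn)
  have nsp: "normalize_vec n x \<in> space (borel_Rn n)" "mat_app n U x \<in> space (borel_Rn n)" for x
    by (auto simp: normalize_vec_def mat_app_def space_PiM)
  have BN: "unit_ball n \<inter> ?NA \<in> sets (borel_Rn n)"
    by (intro sets.Int sets_unit_ball measurable_sets[OF measurable_normalize_vec AR])
  have "unit_ball n \<inter> (normalize_vec n -` ?UA \<inter> space (borel_Rn n)) =
      mat_app n U -` (unit_ball n \<inter> ?NA) \<inter> space ?L"
    using nsp ball by (auto simp: comm space_lborel_Rn)
  then have eq: "emeasure ?D ?UA = emeasure ?D A"
    by (simp only: D[OF UA] D[OF AR] emeasure_lborel_Rn_orthogonal[OF U BN])
  have "emeasure (distr (sphere_measure n) (sphere_measure n) (mat_app n U)) A =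
      emeasure (sphere_measure n) ?UA"
    using A meas by (simp add: emeasure_distr pre)
  also have "\<dots> = emeasure (sphere_measure n) A"
    using UAS AS S eq by (simp add: sphere_measure_def emeasure_restrict_space)
  finally show "emeasure (distr (sphere_measure n) (sphere_measure n) (mat_app n U)) A =
      emeasure (sphere_measure n) A" .
qed simp

end

theory Submission
  imports Defs
begin

text \<open>
  Centering removes the linear part of \<open>t\<^sub>+ = (t + \<bar>t\<bar>) / 2\<close>, so \<open>F(\<theta>) = (1/2) \<integral> \<bar>x \<cdot> \<theta>\<bar> d\<mu>(x)\<close>. By Fubini,
  the second moment of \<open>F\<close> on the sphere is a double \<open>\<mu>\<close>-integral of \<open>\<bar>x\<bar> \<bar>y\<bar> K(t) / 4\<close>, where \<open>t\<close> is the
  cosine of the angle between \<open>x\<close> and \<open>y\<close> and \<open>K(t)\<close> is the sphere average of \<open>\<bar>\<theta> \<cdot> u\<bar> \<bar>\<theta> \<cdot> v\<bar>\<close> for unit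
  vectors with \<open>u \<cdot> v = t\<close>; the mean of \<open>F\<close> involves in the same way the constant average of \<open>\<bar>\<theta> \<cdot> u\<bar>\<close>.

  Both averages are computed through a standard Gaussian vector \<open>G\<close>, whose length is independent of its
  direction (\<open>gauss_polar_coordinates\<close>). The constant is \<open>sqrt(2/\<pi>) / E\<bar>G\<bar>\<close>, and
  \<open>K(t) = (2 / (\<pi> n)) (sqrt(1 - t\<^sup>2) + t arcsin t)\<close>. This is an even power series
  \<open>(2 / (\<pi> n)) (1 + t\<^sup>2/2 + t\<^sup>4/24 + \<dots>)\<close> whose remainder is at most \<open>24 t\<^sup>6\<close>
  inside the bracket (\<open>sphere_kernel_bound\<close>). Integrated against \<open>\<mu>\<close>, the terms
  of degree \<open>0\<close> and \<open>2\<close> are \<open>\<alpha>\<^sup>2 n\<close> and \<open>\<alpha>\<^sup>2 / 2\<close> by the isotropy of \<open>Cov\<^sub>1\<close>; those of degree \<open>4\<close> and \<open>6\<close> are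
  controlled by the two moment hypotheses. Hence the second moment of \<open>F\<close> is at most
  \<open>(\<alpha>\<^sup>2 / (2 \<pi>)) (1 + 1/(2n) + 1/(8n\<^sup>2) + (\<gamma>/24 + 24\<delta>) / n\<^sup>3)\<close>.

  For the square of the mean one needs a sharp upper bound for \<open>E\<bar>G\<bar>\<close>: \<open>gauss_mean_norm_upper_bound\<close>
  gives \<open>(E\<bar>G\<bar>)\<^sup>2 \<le> n - 1/2 + 1/(8(n - 1))\<close>, so that the squared mean of \<open>F\<close> is at least
  \<open>(\<alpha>\<^sup>2 / (2 \<pi>)) (1 + 1/(2n) + 1/(8n\<^sup>2) - 1/n\<^sup>3)\<close>. The first three terms cancel, which is where the value
  \<open>3\<close> in the fourth moment hypothesis is decisive, and a quantity of order \<open>n\<^sup>-\<^sup>3\<close> is left.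
  In dimension \<open>1\<close> the trivial bound \<open>F \<le> (1/2) \<integral> \<bar>x\<bar> d\<mu>\<close> suffices.
\<close>

section \<open>Polar coordinates\<close>

lemma emeasure_lborel_scale:
  fixes c :: real
  assumes "c > 0" and [measurable]: "A \<in> sets borel"
  shows "ennreal c * emeasure lborel ((*) c -` A) = emeasure lborel A"
proof -
  have "emeasure lborel ((*) c -` A) = emeasure (distr lborel borel ((*) c)) A"
    by (subst emeasure_distr) auto
  also have "\<dots> = ennreal (inverse c) * emeasure lborel A"
    using assms by (simp add: lborel_distr_mult emeasure_density nn_integral_cmult)
  finally show ?thesis
    using assms by (simp add: mult.assoc[symmetric] ennreal_mult'[symmetric])
qed

definition vec_scale :: "nat \<Rightarrow> real \<Rightarrow> (nat \<Rightarrow> real) \<Rightarrow> nat \<Rightarrow> real" where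
  "vec_scale n c x = (\<lambda>i\<in>{..<n}. c * x i)"

lemma measurable_vec_scale [measurable]: "vec_scale n c \<in> borel_Rn n \<rightarrow>\<^sub>M borel_Rn n"
  unfolding vec_scale_def by (intro measurable_restrict) measurable

text \<open>
  Lebesgue measure is characterised by its values on boxes, and a box scales coordinate by coordinate.
\<close>

lemma nn_integral_lborel_Rn_scale:
  assumes c: "c > 0" and [measurable]: "f \<in> borel_measurable (borel_Rn n)"
  shows "(\<integral>\<^sup>+x. f x \<partial>lborel_Rn n) = ennreal (c ^ n) * (\<integral>\<^sup>+x. f (vec_scale n c x) \<partial>lborel_Rn n)"
proof -
  interpret product_sigma_finite "\<lambda>_::nat. lborel :: real measure" by standard
  have meas [measurable]: "vec_scale n c \<in> lborel_Rn n \<rightarrow>\<^sub>M lborel_Rn n"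
    unfolding vec_scale_def by (intro measurable_restrict) measurable
  have "scale_measure (ennreal (c ^ n)) (distr (lborel_Rn n) (lborel_Rn n) (vec_scale n c)) = lborel_Rn n"
  proof (rule PiM_eqI)
    fix A :: "nat \<Rightarrow> real set"
    assume A: "\<And>i. i \<in> {..<n} \<Longrightarrow> A i \<in> sets lborel"
    have A': "(*) c -` A i \<in> sets lborel" if "i < n" for i
      using measurable_sets[of "(*) c" borel borel "A i"] A[of i] that by simp
    have pre: "vec_scale n c -` Pi\<^sub>E {..<n} A \<inter> space (lborel_Rn n) =
        Pi\<^sub>E {..<n} (\<lambda>i. (*) c -` A i)"
      by (auto simp: vec_scale_def space_PiM PiE_iff)
    have "emeasure (scale_measure (ennreal (c ^ n)) (distr (lborel_Rn n) (lborel_Rn n) (vec_scale n c))) (Pi\<^sub>E {..<n} A) =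
        ennreal c ^ n * emeasure (lborel_Rn n) (Pi\<^sub>E {..<n} (\<lambda>i. (*) c -` A i))"
      using A c by (subst emeasure_scale_measure, subst emeasure_distr)
         (auto simp: pre ennreal_power intro!: sets_PiM_I_finite)
    also have "\<dots> = ennreal c ^ n * (\<Prod>i<n. emeasure lborel ((*) c -` A i))"
      using A' by (subst emeasure_PiM) auto
    also have "\<dots> = (\<Prod>i<n. ennreal c * emeasure lborel ((*) c -` A i))"
      by (simp add: prod.distrib)
    also have "\<dots> = (\<Prod>i<n. emeasure lborel (A i))"
      using A c by (intro prod.cong emeasure_lborel_scale) auto
    finally show "emeasure (scale_measure (ennreal (c ^ n)) (distr (lborel_Rn n) (lborel_Rn n) (vec_scale n c))) (Pi\<^sub>E {..<n} A) =
        (\<Prod>i<n. emeasure lborel (A i))" .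
  qed simp_all
  then have "(\<integral>\<^sup>+x. f x \<partial>lborel_Rn n) =
      (\<integral>\<^sup>+x. f x \<partial>scale_measure (ennreal (c ^ n)) (distr (lborel_Rn n) (lborel_Rn n) (vec_scale n c)))"
    by simp
  also have "\<dots> = ennreal (c ^ n) * (\<integral>\<^sup>+x. f (vec_scale n c x) \<partial>lborel_Rn n)"
    by (subst nn_integral_scale_measure, simp, subst nn_integral_distr) simp_all
  finally show ?thesis .
qed

lemma nrm_vec_scale: "c \<ge> 0 \<Longrightarrow> nrm n (vec_scale n c x) = c * nrm n x"
proof -
  assume c: "c \<ge> 0"
  have "nrm n (vec_scale n c x) = L2_set (\<lambda>i. c * x i) {..<n}"
    by (intro L2_set_cong) (auto simp: vec_scale_def)
  then show ?thesis using c by (simp add: L2_set_right_distrib)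
qed

lemma normalize_vec_scale: "c > 0 \<Longrightarrow> normalize_vec n (vec_scale n c x) = normalize_vec n x"
  by (auto simp: normalize_vec_def nrm_vec_scale fun_eq_iff) (auto simp: vec_scale_def)

lemma measurable_nrm [measurable]: "nrm n \<in> borel_measurable (borel_Rn n)"
  unfolding L2_set_def by measurable

text \<open>
  The indicator of the sphere that comes from the restriction in the definition of the sphere measure
  is almost surely \<open>1\<close>, as \<open>x/\<bar>x\<bar>\<close> misses the sphere only for \<open>x = 0\<close>.
\<close>

lemma nn_integral_sphere_measure:
  assumes n: "n \<ge> 1" and [measurable]: "g \<in> borel_measurable (borel_Rn n)"
  shows "(\<integral>\<^sup>+x. g (normalize_vec n x) * indicator (unit_ball n) x \<partial>lborel_Rn n) =
    ennreal (unit_ball_vol (real n)) * (\<integral>\<^sup>+\<theta>. g \<theta> \<partial>sphere_measure n)"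
proof -
  let ?L = "lborel_Rn n" and ?B = "unit_ball n" and ?V = "ennreal (unit_ball_vol (real n))"
  have V0: "unit_ball_vol (real n) \<noteq> 0"
    using unit_ball_vol_pos[of "real n"] by linarith
  have "(\<integral>\<^sup>+\<theta>. g \<theta> \<partial>sphere_measure n) =
     (\<integral>\<^sup>+\<theta>. g \<theta> * indicator (unit_sphere n) \<theta> \<partial>distr (uniform_measure ?L ?B) (borel_Rn n) (normalize_vec n))"
    unfolding sphere_measure_def by (rule nn_integral_restrict_space) (auto simp: unit_sphere_def L2_set_def)
  also have "\<dots> = (\<integral>\<^sup>+x. g (normalize_vec n x) * indicator (unit_sphere n) (normalize_vec n x) \<partial>uniform_measure ?L ?B)"
    by (rule nn_integral_distr) measurable
  also have "\<dots> = (\<integral>\<^sup>+x. g (normalize_vec n x) * indicator (unit_sphere n) (normalize_vec n x) * indicator ?B x \<partial>?L) / ?V"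
    by (subst nn_integral_uniform_measure) (simp_all add: emeasure_unit_ball sets_lborel_Rn)
  also have "(\<integral>\<^sup>+x. g (normalize_vec n x) * indicator (unit_sphere n) (normalize_vec n x) * indicator ?B x \<partial>?L) =
      (\<integral>\<^sup>+x. g (normalize_vec n x) * indicator ?B x \<partial>?L)"
    using AE_nrm_nonzero[OF n]
    by (intro nn_integral_cong_AE, eventually_elim) (simp add: normalize_vec_in_sphere)
  finally show ?thesis
    using V0 mult_divide_eq_ennreal[of ?V] by (simp add: ennreal_times_divide mult.commute[of ?V])
qed

text \<open>
  For fixed \<open>g\<close>, weigh Lebesgue measure by \<open>g(x/\<bar>x\<bar>)\<close> and push it forward to \<open>\<bar>x\<bar>\<close>. Since \<open>g(x/\<bar>x\<bar>)\<close> does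
  not change under scaling, the mass of \<open>{\<bar>x\<bar> \<le> a}\<close> is \<open>a\<^sup>n\<close> times that of the unit ball, and this
  determines the radial measure. Finiteness of the sphere integral makes the radial measure sigma-finite.
\<close>

lemma polar_coordinates:
  assumes n: "n \<ge> 1" and g [measurable]: "g \<in> borel_measurable (borel_Rn n)"
    and h [measurable]: "h \<in> borel_measurable borel"
    and fin: "(\<integral>\<^sup>+\<theta>. g \<theta> \<partial>sphere_measure n) < \<infinity>"
  shows "(\<integral>\<^sup>+x. h (nrm n x) * g (normalize_vec n x) \<partial>lborel_Rn n) =
    ennreal (real n * unit_ball_vol (real n)) * (\<integral>\<^sup>+\<theta>. g \<theta> \<partial>sphere_measure n) *
    (\<integral>\<^sup>+s. h s * ennreal (s ^ (n - 1)) * indicator {0..} s \<partial>lborel)"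
proof -
  let ?L = "lborel_Rn n" and ?G = "\<integral>\<^sup>+\<theta>. g \<theta> \<partial>sphere_measure n"
  define c where "c = ennreal (unit_ball_vol (real n)) * ?G"
  have c_fin: "c < \<infinity>" using fin by (simp add: c_def ennreal_mult_less_top)
  \<comment> \<open>The radial measure \<open>\<nu>\<close> is compared with the measure \<open>\<rho>\<close> of density \<open>c n s\<^sup>n\<^sup>-\<^sup>1\<close> on \<open>[0, \<infinity>)\<close>.\<close>
  define \<nu> where "\<nu> = distr (density ?L (\<lambda>x. g (normalize_vec n x))) borel (nrm n)"
  define \<rho> where "\<rho> = density lborel (\<lambda>s. c * ennreal (real n * s ^ (n - 1)) * indicator {0::real..} s)"
  have \<nu>: "emeasure \<nu> {..a} = (\<integral>\<^sup>+x. g (normalize_vec n x) * indicator {..a} (nrm n x) \<partial>?L)" for a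
  proof -
    have "emeasure \<nu> {..a} = (\<integral>\<^sup>+x. indicator {..a} x \<partial>\<nu>)" by (simp add: \<nu>_def)
    also have "\<dots> = (\<integral>\<^sup>+x. g (normalize_vec n x) * indicator {..a} (nrm n x) \<partial>?L)"
      unfolding \<nu>_def by (subst nn_integral_distr, simp, simp, subst nn_integral_density) simp_all
    finally show ?thesis .
  qed
  have \<nu>_pos: "emeasure \<nu> {..a} = c * ennreal (a ^ n)" if a: "a > 0" for a
  proof -
    have "emeasure \<nu> {..a} = ennreal (a ^ n) *
       (\<integral>\<^sup>+x. g (normalize_vec n (vec_scale n a x)) * indicator {..a} (nrm n (vec_scale n a x)) \<partial>?L)"
      unfolding \<nu> by (rule nn_integral_lborel_Rn_scale[OF a]) measurable
    also have "(\<integral>\<^sup>+x. g (normalize_vec n (vec_scale n a x)) * indicator {..a} (nrm n (vec_scale n a x)) \<partial>?L) =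
        (\<integral>\<^sup>+x. g (normalize_vec n x) * indicator (unit_ball n) x \<partial>?L)"
      using a by (intro nn_integral_cong)
        (auto simp: normalize_vec_scale nrm_vec_scale unit_ball_def space_lborel_Rn indicator_def field_simps)
    also have "\<dots> = c" unfolding c_def by (rule nn_integral_sphere_measure[OF n g])
    finally show ?thesis by (simp add: mult.commute)
  qed
  have \<nu>_neg: "emeasure \<nu> {..a} = 0" if a: "a \<le> 0" for a
  proof -
    have "(\<integral>\<^sup>+x. g (normalize_vec n x) * indicator {..a} (nrm n x) \<partial>?L) = (\<integral>\<^sup>+x. 0 \<partial>?L)"
      using AE_nrm_nonzero[OF n]
    proof (intro nn_integral_cong_AE, eventually_elim)
      fix x assume "nrm n x \<noteq> 0"
      then have "nrm n x > a" using a L2_set_nonneg[of x "{..<n}"] by linarith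
      then show "g (normalize_vec n x) * indicator {..a} (nrm n x) = 0" by simp
    qed
    then show ?thesis by (simp add: \<nu>)
  qed
  have \<rho>_pos: "emeasure \<rho> {..a} = c * ennreal (a ^ n)" if a: "a \<ge> 0" for a
  proof -
    have "emeasure \<rho> {..a} = (\<integral>\<^sup>+s. c * (ennreal (real n * s ^ (n - 1)) * indicator {0..a} s) \<partial>lborel)"
      unfolding \<rho>_def by (subst emeasure_density) (auto intro!: nn_integral_cong simp: indicator_def)
    also have "\<dots> = c * (\<integral>\<^sup>+s. ennreal (real n * s ^ (n - 1)) * indicator {0..a} s \<partial>lborel)"
      by (rule nn_integral_cmult) measurable
    also have "(\<integral>\<^sup>+s. ennreal (real n * s ^ (n - 1)) * indicator {0..a} s \<partial>lborel) = ennreal (a ^ n - 0 ^ n)"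
      using a n by (intro nn_integral_FTC_Icc) (auto intro!: derivative_eq_intros)
    finally show ?thesis using n by (simp add: power_0_left)
  qed
  have \<rho>_neg: "emeasure \<rho> {..a} = 0" if a: "a < 0" for a
  proof -
    have "emeasure \<rho> {..a} \<le> emeasure \<rho> {..0}"
      using a by (intro emeasure_mono) (auto simp: \<rho>_def)
    then show ?thesis using \<rho>_pos[of 0] n by (simp add: power_0_left)
  qed
  have eq: "emeasure \<nu> {..a} = emeasure \<rho> {..a}" for a :: real
    using \<nu>_pos[of a] \<nu>_neg[of a] \<rho>_pos[of a] \<rho>_neg[of a] n by (cases a "0::real" rule: linorder_cases) auto
  have "\<nu> = \<rho>"
  proof (rule measure_eqI_generator_eq[where E="range (\<lambda>a::real. {..a})" and \<Omega>=UNIV and A="\<lambda>i. {..real i}"])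
    show "Int_stable (range (\<lambda>a::real. {..a}))"
      by (auto simp: Int_stable_def intro!: exI[of _ "min _ _"])
    show "emeasure \<nu> X = emeasure \<rho> X" if "X \<in> range (\<lambda>a::real. {..a})" for X
      using that eq by auto
    show "sets \<nu> = sigma_sets UNIV (range (\<lambda>a::real. {..a}))" "sets \<rho> = sigma_sets UNIV (range (\<lambda>a::real. {..a}))"
      by (simp_all add: \<nu>_def \<rho>_def borel_eq_atMost)
    show "(\<Union>i. {..real i}) = UNIV" by (auto intro: real_arch_simple)
    show "emeasure \<nu> {..real i} \<noteq> \<infinity>" for i
      using \<rho>_pos[of "real i"] c_fin by (simp add: eq ennreal_mult_eq_top_iff)
  qed auto
  have "(\<integral>\<^sup>+x. h (nrm n x) * g (normalize_vec n x) \<partial>?L) = (\<integral>\<^sup>+s. h s \<partial>\<nu>)"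
    unfolding \<nu>_def by (subst nn_integral_distr, simp, simp, subst nn_integral_density) (simp_all add: mult.commute)
  also have "\<dots> = (\<integral>\<^sup>+s. c * ennreal (real n * s ^ (n - 1)) * indicator {0..} s * h s \<partial>lborel)"
    unfolding \<open>\<nu> = \<rho>\<close> \<rho>_def by (rule nn_integral_density) measurable
  also have "\<dots> = (\<integral>\<^sup>+s. (c * ennreal (real n)) * (h s * ennreal (s ^ (n - 1)) * indicator {0..} s) \<partial>lborel)"
    by (intro nn_integral_cong) (auto simp: indicator_def ennreal_mult' mult_ac)
  also have "\<dots> = (c * ennreal (real n)) * (\<integral>\<^sup>+s. h s * ennreal (s ^ (n - 1)) * indicator {0..} s \<partial>lborel)"
    by (rule nn_integral_cmult) measurable
  finally show ?thesis by (simp add: c_def ennreal_mult' mult_ac)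
qed

section \<open>Standard Gaussian vectors\<close>

definition gauss_abs_moment :: "nat \<Rightarrow> real" where
  "gauss_abs_moment k = (\<integral>x. std_normal_density x * \<bar>x\<bar> ^ k \<partial>lborel)"

lemma gauss_abs_moment_even: "gauss_abs_moment (2 * k) = fact (2 * k) / (2 ^ k * fact k)"
  using integral_std_normal_moment_even[of k] by (simp add: gauss_abs_moment_def power_even_abs)

lemma gauss_abs_moment_odd: "gauss_abs_moment (2 * k + 1) = sqrt (2 / pi) * 2 ^ k * fact k"
  unfolding gauss_abs_moment_def by (rule integral_std_normal_moment_abs_odd)

lemma gauss_abs_moment_pos: "gauss_abs_moment k > 0"
proof (cases "even k")
  case True
  then show ?thesis by (elim evenE) (simp add: gauss_abs_moment_even)
next
  case False
  then show ?thesis by (elim oddE) (simp only: gauss_abs_moment_odd, simp)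
qed

lemma gauss_abs_moment_rec: "gauss_abs_moment (k + 2) = (real k + 1) * gauss_abs_moment k"
proof (cases "even k")
  case True
  then obtain j where j: "k = 2 * j" by (elim evenE)
  have "gauss_abs_moment (k + 2) = fact (2 * Suc j) / (2 ^ Suc j * fact (Suc j))"
    using gauss_abs_moment_even[of "Suc j"] by (simp add: j)
  also have "\<dots> = (real k + 1) * (fact (2 * j) / (2 ^ j * fact j))"
  proof -
    have "fact (2 * Suc j) = 2 * (real j + 1) * (real k + 1) * fact (2 * j)"
      by (simp add: j algebra_simps)
    moreover have "2 ^ Suc j * fact (Suc j) = 2 * (real j + 1) * (2 ^ j * fact j)"
      by (simp add: algebra_simps)
    ultimately show ?thesis by (simp del: fact_Suc power_Suc mult_Suc_right)
  qed
  finally show ?thesis by (simp add: j gauss_abs_moment_even)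
next
  case False
  then obtain j where j: "k = 2 * j + 1" by (elim oddE)
  have "gauss_abs_moment (k + 2) = sqrt (2 / pi) * 2 ^ Suc j * fact (Suc j)"
    using gauss_abs_moment_odd[of "Suc j"] by (simp add: j)
  also have "\<dots> = (real k + 1) * (sqrt (2 / pi) * 2 ^ j * fact j)"
    by (simp add: j field_simps)
  finally show ?thesis unfolding j gauss_abs_moment_odd .
qed

text \<open>
  The Cauchy-Schwarz inequality, in the form \<open>\<integral> \<phi>(x) \<bar>x\<bar>\<^sup>k (\<bar>x\<bar> - c)\<^sup>2 dx \<ge> 0\<close> for the minimising \<open>c\<close>.
\<close>

lemma gauss_abs_moment_log_convex:
  "(gauss_abs_moment (k + 1))\<^sup>2 \<le> gauss_abs_moment k * gauss_abs_moment (k + 2)"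
proof -
  let ?a = gauss_abs_moment and ?\<phi> = std_normal_density
  define c where "c = ?a (k + 1) / ?a k"
  have "0 \<le> (\<integral>x. ?\<phi> x * \<bar>x\<bar> ^ k * (\<bar>x\<bar> - c)\<^sup>2 \<partial>lborel)"
    by (intro integral_nonneg_AE) simp
  also have "\<dots> = (\<integral>x. ?\<phi> x * \<bar>x\<bar> ^ (k + 2) - 2 * c * (?\<phi> x * \<bar>x\<bar> ^ (k + 1)) + c\<^sup>2 * (?\<phi> x * \<bar>x\<bar> ^ k) \<partial>lborel)"
    by (intro Bochner_Integration.integral_cong) (simp_all add: power2_diff algebra_simps power2_eq_square)
  also have "\<dots> = ?a (k + 2) - 2 * c * ?a (k + 1) + c\<^sup>2 * ?a k"
    using integrable_std_normal_moment_abs[of k] integrable_std_normal_moment_abs[of "k + 1"]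
      integrable_std_normal_moment_abs[of "k + 2"]
    by (simp add: gauss_abs_moment_def)
  also have "\<dots> = ?a (k + 2) - (?a (k + 1))\<^sup>2 / ?a k"
    using gauss_abs_moment_pos[of k] by (simp add: c_def field_simps power2_eq_square)
  finally show ?thesis
    using gauss_abs_moment_pos[of k] by (simp add: field_simps)
qed

lemma nn_integral_gauss_abs_moment:
  "(\<integral>\<^sup>+x. ennreal (std_normal_density x * \<bar>x\<bar> ^ k) \<partial>lborel) = ennreal (gauss_abs_moment k)"
  unfolding gauss_abs_moment_def
  by (rule nn_integral_eq_integral[OF integrable_std_normal_moment_abs]) simp

lemma nn_integral_split_reflect:
  fixes f :: "real \<Rightarrow> ennreal"
  assumes [measurable]: "f \<in> borel_measurable borel"
  shows "(\<integral>\<^sup>+z. f z \<partial>lborel) =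
    (\<integral>\<^sup>+z. f z * indicator {a..} z \<partial>lborel) + (\<integral>\<^sup>+z. f (- z) * indicator {- a..} z \<partial>lborel)"
proof -
  have "(\<integral>\<^sup>+z. f z \<partial>lborel) = (\<integral>\<^sup>+z. f z * indicator {a..} z + f z * indicator {..a} z \<partial>lborel)"
    using AE_lborel_singleton[of a]
    by (intro nn_integral_cong_AE, eventually_elim) (auto simp: indicator_def)
  also have "\<dots> = (\<integral>\<^sup>+z. f z * indicator {a..} z \<partial>lborel) + (\<integral>\<^sup>+z. f z * indicator {..a} z \<partial>lborel)"
    by (rule nn_integral_add) measurable
  also have "(\<integral>\<^sup>+z. f z * indicator {..a} z \<partial>lborel) = (\<integral>\<^sup>+z. f (- z) * indicator {- a..} z \<partial>lborel)"
  proof -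
    have "(\<integral>\<^sup>+z. f z * indicator {..a} z \<partial>lborel) = (\<integral>\<^sup>+z. f (- z) * indicator {..a} (- z) \<partial>lborel)"
      using nn_integral_real_affine[of "\<lambda>z. f z * indicator {..a} z" "-1" 0] by simp
    also have "(\<lambda>z. f (- z) * indicator {..a} (- z)) = (\<lambda>z. f (- z) * indicator {- a..} z)"
      by (auto simp: fun_eq_iff indicator_def)
    finally show ?thesis .
  qed
  finally show ?thesis .
qed

lemma nn_integral_gauss_half_moment:
  "(\<integral>\<^sup>+s. ennreal (std_normal_density s * \<bar>s\<bar> ^ k) * indicator {0..} s \<partial>lborel) = ennreal (gauss_abs_moment k / 2)"
proof -
  let ?J = "\<integral>\<^sup>+s. ennreal (std_normal_density s * \<bar>s\<bar> ^ k) * indicator {0..} s \<partial>lborel"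
  have even: "std_normal_density (- s) = std_normal_density s" for s
    by (simp add: normal_density_def)
  have "ennreal (gauss_abs_moment k) = 2 * ?J"
    using nn_integral_split_reflect[of "\<lambda>s. ennreal (std_normal_density s * \<bar>s\<bar> ^ k)" 0]
    unfolding nn_integral_gauss_abs_moment by (simp add: even mult_2)
  moreover have "ennreal (gauss_abs_moment k) = 2 * ennreal (gauss_abs_moment k / 2)"
    using ennreal_mult'[of 2 "gauss_abs_moment k / 2"] by simp
  ultimately have "2 * ?J = 2 * ennreal (gauss_abs_moment k / 2)"
    by (rule trans[OF sym])
  then show ?thesis
    by (subst (asm) ennreal_mult_cancel_left) simp
qed

definition gauss_density :: "nat \<Rightarrow> (nat \<Rightarrow> real) \<Rightarrow> real" where
  "gauss_density n x = (\<Prod>i<n. std_normal_density (x i))"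

lemma gauss_density_nonneg [simp]: "gauss_density n x \<ge> 0"
  by (simp add: gauss_density_def prod_nonneg)

lemma measurable_gauss_density [measurable]: "gauss_density n \<in> borel_measurable (borel_Rn n)"
  unfolding gauss_density_def by measurable

text \<open>
  Only one of the \<open>n\<close> normalising factors stays in the one-dimensional density of \<open>\<bar>x\<bar>\<close>. In this form the
  radial integrals become one-dimensional Gaussian moments, up to a constant independent of the moment.
\<close>

lemma gauss_density_radial:
  assumes "n \<ge> 1"
  shows "gauss_density n x = (1 / sqrt (2 * pi)) ^ (n - 1) * std_normal_density (nrm n x)"
proof -
  have "gauss_density n x = (1 / sqrt (2 * pi)) ^ n * (\<Prod>i<n. exp (- (x i)\<^sup>2 / 2))"
    by (simp add: gauss_density_def normal_density_def prod.distrib prod_dividef power_divide)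
  also have "(\<Prod>i<n. exp (- (x i)\<^sup>2 / 2)) = exp (- (nrm n x)\<^sup>2 / 2)"
    by (simp add: exp_sum[symmetric] L2_set_def sum_nonneg sum_negf sum_divide_distrib[symmetric])
  also have "(1 / sqrt (2 * pi)) ^ n = (1 / sqrt (2 * pi)) ^ (n - 1) * (1 / sqrt (2 * pi))"
    using assms by (subst power_Suc2[symmetric]) simp
  finally show ?thesis by (simp add: normal_density_def)
qed

lemma nn_integral_gauss_coordinate:
  assumes [simp]: "finite I" and "j \<in> I" and [measurable]: "f \<in> borel_measurable borel"
  shows "(\<integral>\<^sup>+x. f (x j) * ennreal (\<Prod>i\<in>I. std_normal_density (x i)) \<partial>Pi\<^sub>M I (\<lambda>_. lborel)) =
    (\<integral>\<^sup>+y. f y * ennreal (std_normal_density y) \<partial>lborel)"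
proof -
  interpret product_sigma_finite "\<lambda>_. lborel :: real measure" by standard
  define F where "F i = (\<lambda>y. (if i = j then f y else 1) * ennreal (std_normal_density y))" for i
  have one: "(\<integral>\<^sup>+y. ennreal (std_normal_density y) \<partial>lborel) = 1"
    using nn_integral_gauss_abs_moment[of 0] gauss_abs_moment_even[of 0] by simp
  have "(\<Prod>i\<in>I. F i (x i)) = f (x j) * ennreal (\<Prod>i\<in>I. std_normal_density (x i))" for x
    using assms(1,2) by (simp add: F_def prod.distrib prod_ennreal)
  then have "(\<integral>\<^sup>+x. f (x j) * ennreal (\<Prod>i\<in>I. std_normal_density (x i)) \<partial>Pi\<^sub>M I (\<lambda>_. lborel)) =
      (\<integral>\<^sup>+x. (\<Prod>i\<in>I. F i (x i)) \<partial>Pi\<^sub>M I (\<lambda>_. lborel))"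
    by simp
  also have "\<dots> = (\<Prod>i\<in>I. integral\<^sup>N lborel (F i))"
    by (rule product_nn_integral_prod) (auto simp: F_def)
  also have "\<dots> = (\<Prod>i\<in>I. if i = j then integral\<^sup>N lborel (F j) else 1)"
    by (intro prod.cong) (auto simp: F_def one)
  also have "\<dots> = integral\<^sup>N lborel (F j)" using assms by simp
  finally show ?thesis by (simp add: F_def)
qed

text \<open>
  The other \<open>n - 2\<close> coordinates integrate out: two independent standard Gaussians remain.
\<close>

lemma nn_integral_gauss_two_coordinates:
  assumes n: "n \<ge> 2" and [measurable]: "(\<lambda>p. f (fst p) (snd p)) \<in> borel_measurable (borel \<Otimes>\<^sub>M borel)"
  shows "(\<integral>\<^sup>+x. f (x 0) (x 1) * ennreal (gauss_density n x) \<partial>lborel_Rn n) =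
    (\<integral>\<^sup>+x. \<integral>\<^sup>+y. f x y * ennreal (std_normal_density x * std_normal_density y) \<partial>lborel \<partial>lborel)"
proof -
  interpret product_sigma_finite "\<lambda>_. lborel :: real measure" by standard
  have I: "{..<n} = insert 0 {1..<n}" using n by auto
  have f1 [measurable]: "(\<lambda>x. f (g x) (h x)) \<in> borel_measurable M"
    if [measurable]: "g \<in> borel_measurable M" "h \<in> borel_measurable M" for g h and M :: "'b measure"
    using measurable_compose[OF measurable_Pair[OF that] assms(2)] by simp
  have coord [measurable]: "(\<lambda>x. x i) \<in> borel_measurable (borel_Rn n)" if "i < n" for i
    using measurable_component_singleton[of i "{..<n}" "\<lambda>_. borel"] that by simp
  have [measurable]: "(\<lambda>x. x 0) \<in> borel_measurable (borel_Rn n)" "(\<lambda>x. x 1) \<in> borel_measurable (borel_Rn n)"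
    using coord n by auto
  have "(\<lambda>x. f (x 0) (x 1) * ennreal (gauss_density n x)) \<in> borel_measurable (borel_Rn n)"
    by measurable
  then have m: "(\<lambda>x. f (x 0) (x 1) * ennreal (gauss_density n x)) \<in> borel_measurable (lborel_Rn n)"
    by (simp cong: measurable_cong_sets add: sets_lborel_Rn)
  have "(\<integral>\<^sup>+x. f (x 0) (x 1) * ennreal (gauss_density n x) \<partial>lborel_Rn n) =
     (\<integral>\<^sup>+y. \<integral>\<^sup>+x. f ((x(0 := y)) 0) ((x(0 := y)) 1) * ennreal (gauss_density n (x(0 := y)))
       \<partial>Pi\<^sub>M {1..<n} (\<lambda>_. lborel) \<partial>lborel)"
    using m unfolding I by (intro product_nn_integral_insert_rev) auto
  also have "\<dots> = (\<integral>\<^sup>+y. \<integral>\<^sup>+z. f y z * ennreal (std_normal_density y * std_normal_density z) \<partial>lborel \<partial>lborel)"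
  proof (rule nn_integral_cong)
    fix y :: real
    have "gauss_density n (x(0 := y)) = std_normal_density y * (\<Prod>i\<in>{1..<n}. std_normal_density (x i))" for x
      unfolding gauss_density_def I by (subst prod.insert) (auto intro!: prod.cong)
    then have "(\<integral>\<^sup>+x. f ((x(0 := y)) 0) ((x(0 := y)) 1) * ennreal (gauss_density n (x(0 := y))) \<partial>Pi\<^sub>M {1..<n} (\<lambda>_. lborel)) =
       (\<integral>\<^sup>+x. (f y (x 1) * ennreal (std_normal_density y)) * ennreal (\<Prod>i\<in>{1..<n}. std_normal_density (x i)) \<partial>Pi\<^sub>M {1..<n} (\<lambda>_. lborel))"
      by (intro nn_integral_cong) (simp add: ennreal_mult' mult.assoc prod_nonneg)
    also have "\<dots> = (\<integral>\<^sup>+z. f y z * ennreal (std_normal_density y) * ennreal (std_normal_density z) \<partial>lborel)"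
      using n by (intro nn_integral_gauss_coordinate) auto
    finally show "(\<integral>\<^sup>+x. f ((x(0 := y)) 0) ((x(0 := y)) 1) * ennreal (gauss_density n (x(0 := y))) \<partial>Pi\<^sub>M {1..<n} (\<lambda>_. lborel)) =
       (\<integral>\<^sup>+z. f y z * ennreal (std_normal_density y * std_normal_density z) \<partial>lborel)"
      by (simp add: ennreal_mult' mult.assoc)
  qed
  finally show ?thesis .
qed

text \<open>
  Length and direction of a Gaussian vector are independent: the left-hand side is
  \<open>E(\<bar>G\<bar>\<^sup>k g(G/\<bar>G\<bar>))\<close>, and the quotient on the right is \<open>E\<bar>G\<bar>\<^sup>k\<close>, written with one-dimensional absolute
  moments because \<open>\<bar>G\<bar>\<close> has a density proportional to \<open>s\<^sup>n\<^sup>-\<^sup>1 exp(-s\<^sup>2/2)\<close>. For the same reason the constants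
  of the polar formula need not be known: they cancel against the case \<open>k = 0\<close>, \<open>g = 1\<close>.
\<close>

lemma gauss_polar_coordinates:
  assumes n: "n \<ge> 1" and g [measurable]: "g \<in> borel_measurable (borel_Rn n)"
    and fin: "(\<integral>\<^sup>+\<theta>. g \<theta> \<partial>sphere_measure n) < \<infinity>"
  shows "(\<integral>\<^sup>+x. ennreal (nrm n x ^ k) * g (normalize_vec n x) * ennreal (gauss_density n x) \<partial>lborel_Rn n) =
    ennreal (gauss_abs_moment (n - 1 + k) / gauss_abs_moment (n - 1)) * (\<integral>\<^sup>+\<theta>. g \<theta> \<partial>sphere_measure n)"
proof -
  define c where "c = (1 / sqrt (2 * pi)) ^ (n - 1)"
  define D where "D = real n * unit_ball_vol (real n) * c / 2"
  have c: "c \<ge> 0" by (simp add: c_def)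
  have D: "D \<ge> 0" using c by (simp add: D_def)
  have key: "(\<integral>\<^sup>+x. ennreal (nrm n x ^ k) * g (normalize_vec n x) * ennreal (gauss_density n x) \<partial>lborel_Rn n) =
      ennreal (D * gauss_abs_moment (n - 1 + k)) * (\<integral>\<^sup>+\<theta>. g \<theta> \<partial>sphere_measure n)"
    if [measurable]: "g \<in> borel_measurable (borel_Rn n)" and "(\<integral>\<^sup>+\<theta>. g \<theta> \<partial>sphere_measure n) < \<infinity>" for g k
  proof -
    let ?h = "\<lambda>s::real. ennreal (\<bar>s\<bar> ^ k * (c * std_normal_density s))"
    have "(\<integral>\<^sup>+x. ennreal (nrm n x ^ k) * g (normalize_vec n x) * ennreal (gauss_density n x) \<partial>lborel_Rn n) =
        (\<integral>\<^sup>+x. ?h (nrm n x) * g (normalize_vec n x) \<partial>lborel_Rn n)"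
      by (intro nn_integral_cong) (simp add: gauss_density_radial[OF n] c_def ennreal_mult' mult_ac)
    also have "\<dots> = ennreal (real n * unit_ball_vol (real n)) * (\<integral>\<^sup>+\<theta>. g \<theta> \<partial>sphere_measure n) *
        (\<integral>\<^sup>+s. ?h s * ennreal (s ^ (n - 1)) * indicator {0..} s \<partial>lborel)"
      by (rule polar_coordinates[OF n that(1) _ that(2)]) measurable
    also have "(\<integral>\<^sup>+s. ?h s * ennreal (s ^ (n - 1)) * indicator {0..} s \<partial>lborel) =
        (\<integral>\<^sup>+s. ennreal c * (ennreal (std_normal_density s * \<bar>s\<bar> ^ (n - 1 + k)) * indicator {0..} s) \<partial>lborel)"
      using c by (intro nn_integral_cong)
        (auto simp: indicator_def ennreal_mult'[symmetric] power_add mult_ac)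
    also have "\<dots> = ennreal c * ennreal (gauss_abs_moment (n - 1 + k) / 2)"
      by (subst nn_integral_cmult) (simp_all add: nn_integral_gauss_half_moment)
    also have "ennreal (real n * unit_ball_vol (real n)) * (\<integral>\<^sup>+\<theta>. g \<theta> \<partial>sphere_measure n) * (ennreal c * ennreal (gauss_abs_moment (n - 1 + k) / 2)) =
       (ennreal (real n * unit_ball_vol (real n)) * (ennreal c * ennreal (gauss_abs_moment (n - 1 + k) / 2))) * (\<integral>\<^sup>+\<theta>. g \<theta> \<partial>sphere_measure n)"
      by (simp add: mult_ac)
    also have "ennreal (real n * unit_ball_vol (real n)) * (ennreal c * ennreal (gauss_abs_moment (n - 1 + k) / 2)) =
        ennreal (D * gauss_abs_moment (n - 1 + k))"
      using c gauss_abs_moment_pos[of "n - 1 + k"]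
      by (simp add: D_def ennreal_mult'[symmetric] mult_ac)
    finally show ?thesis .
  qed
  interpret S: prob_space "sphere_measure n" by (rule prob_space_sphere_measure[OF n])
  have "ennreal (D * gauss_abs_moment (n - 1)) = (\<integral>\<^sup>+x. 1 * ennreal (gauss_density n x) \<partial>lborel_Rn n)"
    using key[of "\<lambda>_. 1" 0] by (simp add: S.emeasure_space_1)
  also have "\<dots> = (\<integral>\<^sup>+y. 1 * ennreal (std_normal_density y) \<partial>lborel)"
    unfolding gauss_density_def using n by (intro nn_integral_gauss_coordinate[of _ 0 "\<lambda>_. 1"]) auto
  also have "\<dots> = ennreal 1"
    using nn_integral_gauss_abs_moment[of 0] gauss_abs_moment_even[of 0] by simp
  finally have "D * gauss_abs_moment (n - 1) = 1"
    using D gauss_abs_moment_pos[of "n - 1"] by (subst (asm) ennreal_inj) auto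
  then have "D = 1 / gauss_abs_moment (n - 1)"
    using gauss_abs_moment_pos[of "n - 1"] by (simp add: field_simps)
  then show ?thesis using key[OF g fin] by simp
qed


section \<open>The mean norm of a Gaussian vector\<close>

text \<open>
  With the denominators cleared the two sides differ by \<open>3n + 5\<close>. The sequence \<open>b\<close> is the expansion of
  \<open>(E\<bar>G\<bar>)\<^sup>2\<close> up to order \<open>1/n\<close>, with \<open>n - 1\<close> in place of \<open>n\<close> in the last term to get the sign right.
\<close>

lemma ratio_bound_step:
  fixes n :: nat
  assumes "n \<ge> 2"
  defines "b \<equiv> \<lambda>n::nat. real n - 1/2 + 1 / (8 * (real n - 1))"
  shows "(real n + 1)\<^sup>2 * b n \<ge> (real n)\<^sup>2 * b (n + 2)"
proof -
  define x where "x = real n"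
  have x: "x \<ge> 2" using assms(1) by (simp add: x_def)
  have b1: "b n = (8*x^2 - 12*x + 5) / (8 * (x - 1))"
    using x unfolding b_def x_def[symmetric] by (simp add: field_simps power2_eq_square)
  have b2: "b (n + 2) = (8*x^2 + 20*x + 13) / (8 * (x + 1))"
    using x unfolding b_def of_nat_add x_def[symmetric] by (simp add: field_simps power2_eq_square)
  have "(x + 1)^2 * ((8*x^2 - 12*x + 5) * (x + 1)) - x^2 * ((8*x^2 + 20*x + 13) * (x - 1)) = 3 * x + 5"
    by algebra
  then have "x^2 * ((8*x^2 + 20*x + 13) * (x - 1)) \<le> (x + 1)^2 * ((8*x^2 - 12*x + 5) * (x + 1))"
    using x by linarith
  then have "x^2 * ((8*x^2 + 20*x + 13) * (x - 1)) / (8 * ((x + 1) * (x - 1)))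
      \<le> (x + 1)^2 * ((8*x^2 - 12*x + 5) * (x + 1)) / (8 * ((x + 1) * (x - 1)))"
    using x by (intro divide_right_mono) auto
  then have "x^2 * ((8*x^2 + 20*x + 13) / (8 * (x + 1))) \<le> (x + 1)^2 * ((8*x^2 - 12*x + 5) / (8 * (x - 1)))"
    using x by simp
  then show ?thesis unfolding b1 b2 by (simp add: x_def add.commute)
qed

text \<open>
  Let \<open>b\<close> be the bounding sequence. The recurrence gives \<open>q(n+2)/q(n) = (n+1)\<^sup>2/n\<^sup>2\<close>, so by
  \<open>ratio_bound_step\<close> the quotient \<open>q/b\<close> increases along steps of two. It is at most \<open>n/b(n)\<close>, which tends
  to \<open>1\<close>; an increasing sequence with limit at most \<open>1\<close> stays below \<open>1\<close>.
\<close>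

lemma ratio_recurrence_bound:
  fixes q :: "nat \<Rightarrow> real"
  assumes q_pos: "\<And>n. n \<ge> 1 \<Longrightarrow> q n > 0"
    and q_le: "\<And>n. n \<ge> 1 \<Longrightarrow> q n \<le> n"
    and rec: "\<And>n. n \<ge> 1 \<Longrightarrow> q n * q (Suc n) = (real n)\<^sup>2"
    and n: "n \<ge> 2"
  shows "q n \<le> real n - 1/2 + 1 / (8 * (real n - 1))"
proof -
  define b where "b n = real n - 1/2 + 1 / (8 * (real n - 1))" for n :: nat
  have b_pos: "b m > 0" if "m \<ge> 2" for m
  proof -
    have "real m - 1/2 > 0" "1 / (8 * (real m - 1)) \<ge> 0" using that by auto
    then show ?thesis unfolding b_def by linarith
  qed
  have step: "q m / b m \<le> q (m + 2) / b (m + 2)" if m: "m \<ge> 2" for m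
  proof -
    have "q (m + 2) * (real m)\<^sup>2 = q (m + 2) * (q (Suc m) * q m)"
      using rec[of m] m by (simp add: mult.commute)
    also have "\<dots> = (real m + 1)\<^sup>2 * q m"
      using rec[of "Suc m"] by (simp add: mult_ac add.commute)
    finally have q2: "q (m + 2) = (real m + 1)\<^sup>2 * q m / (real m)\<^sup>2"
      using m by (simp add: field_simps)
    have "(real m)\<^sup>2 * b (m + 2) * q m \<le> (real m + 1)\<^sup>2 * b m * q m"
      using ratio_bound_step[OF m] q_pos[of m] m
      by (intro mult_right_mono) (auto simp: b_def)
    then show ?thesis
      unfolding q2 using b_pos[of m] b_pos[of "m+2"] m by (simp add: divide_simps mult_ac)
  qed
  have iter: "q n / b n \<le> q (n + 2 * k) / b (n + 2 * k)" for k
  proof (induction k)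
    case (Suc k)
    then show ?case using step[of "n + 2 * k"] n by simp
  qed simp
  have bound: "q n / b n \<le> real (n + 2 * k) / b (n + 2 * k)" for k
    using iter[of k] divide_right_mono[OF q_le[of "n + 2 * k"], of "b (n + 2 * k)"] n b_pos[of "n + 2 * k"]
    by simp
  have "(\<lambda>m. real m / b m) \<longlonglongrightarrow> 1"
    unfolding b_def by real_asymp
  moreover have "filterlim (\<lambda>k. n + 2 * k) at_top sequentially"
    by (rule filterlim_subseq) (simp add: strict_mono_def)
  ultimately have "(\<lambda>k. real (n + 2 * k) / b (n + 2 * k)) \<longlonglongrightarrow> 1"
    by (rule filterlim_compose)
  then have "q n / b n \<le> 1"
    by (rule LIMSEQ_le_const) (use bound in auto)
  then show ?thesis using b_pos[OF n] by (simp add: b_def)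
qed

text \<open>
  The bound for \<open>(E\<bar>G\<bar>)\<^sup>2\<close> in the form in which it is used: the first factor is \<open>n\<close> times the first three terms
  \<open>1 + 1/(2n) + 1/(8n\<^sup>2)\<close> of \<open>n/(E\<bar>G\<bar>)\<^sup>2\<close>, diminished by \<open>1/n\<^sup>2\<close> to cover the rest of the expansion.
\<close>

lemma inverse_ratio_bound:
  fixes n :: nat
  assumes "n \<ge> 2"
  shows "(real n + 1/2 + 1 / (8 * real n) - 1 / (real n)\<^sup>2) * (real n - 1/2 + 1 / (8 * (real n - 1))) \<le> (real n)\<^sup>2"
proof -
  define x where "x = real n"
  have x: "x \<ge> 2" using assms by (simp add: x_def)
  have e1: "x + 1/2 + 1 / (8 * x) - 1 / x\<^sup>2 = (8*x^3 + 4*x^2 + x - 8) / (8 * x^2)"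
    using x by (simp add: field_simps power2_eq_square power3_eq_cube)
  have e2: "x - 1/2 + 1 / (8 * (x - 1)) = (8*x^2 - 12*x + 5) / (8 * (x - 1))"
    using x by (simp add: field_simps power2_eq_square)
  have "x^2 * (64 * x^2 * (x - 1)) - (8*x^3 + 4*x^2 + x - 8) * (8*x^2 - 12*x + 5) = 
      8 * (x - 2) * (7 * x) + 11 * x + 40"
    by algebra
  moreover have "8 * (x - 2) * (7 * x) + 11 * x + 40 \<ge> 0" using x by simp
  moreover have "x^2 * (64 * x^2 * (x - 1)) = x^2 * ((8 * x^2) * (8 * (x - 1)))" by simp
  ultimately have "(8*x^3 + 4*x^2 + x - 8) * (8*x^2 - 12*x + 5) \<le> x^2 * ((8 * x^2) * (8 * (x - 1)))"
    by linarith
  then show ?thesis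
    unfolding x_def[symmetric] e1 e2 using x by (simp add: divide_le_eq)
qed

text \<open>
  The mean norm \<open>E\<bar>G\<bar>\<close> of a standard Gaussian vector in \<open>\<real>\<^sup>n\<close>, by \<open>gauss_polar_coordinates\<close>; it equals
  \<open>sqrt 2 \<Gamma>((n+1)/2) / \<Gamma>(n/2)\<close>.
\<close>

definition gauss_mean_norm :: "nat \<Rightarrow> real" where
  "gauss_mean_norm n = gauss_abs_moment n / gauss_abs_moment (n - 1)"

lemma gauss_mean_norm_pos: "gauss_mean_norm n > 0"
  by (simp add: gauss_mean_norm_def gauss_abs_moment_pos)

text \<open>
  The mean norms satisfy \<open>m(n) m(n+1) = n\<close> by the moment recurrence and \<open>m(n)\<^sup>2 \<le> n\<close> by log-convexity. These
  two facts determine the expansion of \<open>m(n)\<^sup>2\<close>, through \<open>ratio_recurrence_bound\<close>.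
\<close>

lemma gauss_mean_norm_upper_bound:
  assumes "n \<ge> 2"
  shows "(gauss_mean_norm n)\<^sup>2 \<le> real n - 1/2 + 1 / (8 * (real n - 1))"
proof (rule ratio_recurrence_bound[OF _ _ _ assms])
  let ?a = gauss_abs_moment
  fix n :: nat assume n: "n \<ge> 1"
  have rec: "?a (n + 1) = n * ?a (n - 1)" using gauss_abs_moment_rec[of "n - 1"] n by simp
  show "(gauss_mean_norm n)\<^sup>2 > 0" using gauss_mean_norm_pos[of n] by simp
  have "(?a n)\<^sup>2 \<le> ?a (n - 1) * (n * ?a (n - 1))"
    using gauss_abs_moment_log_convex[of "n - 1"] n rec by simp
  then show "(gauss_mean_norm n)\<^sup>2 \<le> n"
    using gauss_abs_moment_pos[of "n - 1"]
    by (simp add: gauss_mean_norm_def power_divide divide_le_eq power2_eq_square mult_ac)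
  have "gauss_mean_norm n * gauss_mean_norm (Suc n) = n"
    using gauss_abs_moment_pos[of n] gauss_abs_moment_pos[of "n - 1"] rec
    by (simp add: gauss_mean_norm_def)
  then show "(gauss_mean_norm n)\<^sup>2 * (gauss_mean_norm (Suc n))\<^sup>2 = (real n)\<^sup>2"
    by (metis power_mult_distrib)
qed

section \<open>The correlation of two absolute Gaussians\<close>

text \<open>
  Comparison of derivatives. The coefficient \<open>1/5\<close> is larger than the Taylor coefficient \<open>3/40\<close>, which
  leaves room for the tail of the series as long as \<open>t\<^sup>2 \<le> 1/2\<close>.
\<close>

lemma arcsin_upper_bound:
  assumes "0 \<le> t" "t\<^sup>2 \<le> 1/2"
  shows "arcsin t \<le> t + t^3/6 + t^5/5"
proof -
  define f where "f = (\<lambda>t::real. t + t^3/6 + t^5/5 - arcsin t)"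
  have "f 0 \<le> f t"
  proof (rule DERIV_nonneg_imp_nondecreasing[OF assms(1)])
    fix u assume u: "0 \<le> u" "u \<le> t"
    have u2: "u\<^sup>2 \<le> 1/2" using u assms(2) power_mono[of u t 2] by linarith
    have "u < 1" by (rule power2_less_imp_less[of u 1]) (use u2 in auto)
    then have "(f has_real_derivative 1 + u^2/2 + u^4 - inverse (sqrt (1 - u\<^sup>2))) (at u)"
      unfolding f_def using u(1) by (auto intro!: derivative_eq_intros)
    moreover have "inverse (sqrt (1 - u\<^sup>2)) \<le> 1 + u^2/2 + u^4"
    proof -
      define w where "w = u\<^sup>2"
      have w: "0 \<le> w" "w \<le> 1/2" using u2 by (auto simp: w_def)
      have "(1 + w/2 + w\<^sup>2)\<^sup>2 * (1 - w) = 1 + w\<^sup>2 * (5/4 * (1 - w) - w^3)"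
        by (simp add: field_simps power2_eq_square power3_eq_cube)
      moreover have "w^3 \<le> (1/2)^3" using w by (intro power_mono)
      then have "w\<^sup>2 * (5/4 * (1 - w) - w^3) \<ge> 0"
        using w by (intro mult_nonneg_nonneg) (auto simp: power3_eq_cube)
      ultimately have "1 \<le> (1 + w/2 + w\<^sup>2)\<^sup>2 * (1 - w)" by linarith
      then have "sqrt 1 \<le> sqrt ((1 + w/2 + w\<^sup>2)\<^sup>2 * (1 - w))" by (rule real_sqrt_le_mono)
      also have "\<dots> = (1 + w/2 + w\<^sup>2) * sqrt (1 - w)"
        using w by (simp add: real_sqrt_mult)
      finally show ?thesis
        using w by (simp add: w_def[symmetric] field_simps) (simp add: w_def power_mult[symmetric])
    qed
    ultimately show "\<exists>y. (f has_real_derivative y) (at u) \<and> y \<ge> 0" by fastforce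
  qed
  then show ?thesis by (simp add: f_def)
qed

text \<open>
  The derivative of the left-hand side is \<open>arcsin t\<close>, so this is \<open>arcsin_upper_bound\<close> integrated.
\<close>

lemma kernel_upper_bound:
  assumes "0 \<le> t" "t\<^sup>2 \<le> 1/2"
  shows "sqrt (1 - t\<^sup>2) + t * arcsin t \<le> 1 + t^2/2 + t^4/24 + t^6/30"
proof -
  define f where "f = (\<lambda>t::real. 1 + t^2/2 + t^4/24 + t^6/30 - (sqrt (1 - t\<^sup>2) + t * arcsin t))"
  have "f 0 \<le> f t"
  proof (rule DERIV_nonneg_imp_nondecreasing[OF assms(1)])
    fix u assume u: "0 \<le> u" "u \<le> t"
    have u2: "u\<^sup>2 \<le> 1/2" using u assms(2) power_mono[of u t 2] by linarith
    have "u < 1" by (rule power2_less_imp_less[of u 1]) (use u2 in auto)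
    then have "(f has_real_derivative u + u^3/6 + u^5/5 - arcsin u) (at u)"
      unfolding f_def using u(1) u2 by (auto intro!: derivative_eq_intros simp: field_simps)
    then show "\<exists>y. (f has_real_derivative y) (at u) \<and> y \<ge> 0"
      using arcsin_upper_bound[OF u(1) u2] by fastforce
  qed
  then show ?thesis by (simp add: f_def)
qed

text \<open>
  The third absolute moment of the standard Gaussian, rescaled by \<open>sqrt(1 + z\<^sup>2)\<close>.
\<close>

lemma nn_integral_cube_gaussian:
  "(\<integral>\<^sup>+x. ennreal (\<bar>x::real\<bar> ^ 3 * exp (- x\<^sup>2 * (1 + z\<^sup>2) / 2)) \<partial>lborel) = ennreal (4 / (1 + z\<^sup>2)\<^sup>2)"
proof -
  define r where "r = sqrt (1 + z\<^sup>2)"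
  have r: "r > 0" "r\<^sup>2 = 1 + z\<^sup>2" by (auto simp: r_def add_pos_nonneg)
  define d where "d = r ^ 4 / sqrt (2 * pi)"
  have d: "d > 0" using r by (simp add: d_def)
  let ?I = "\<integral>\<^sup>+x. ennreal (\<bar>x::real\<bar> ^ 3 * exp (- x\<^sup>2 * (1 + z\<^sup>2) / 2)) \<partial>lborel"
  have a3: "gauss_abs_moment 3 = sqrt (2 / pi) * 2"
    using gauss_abs_moment_odd[of 1] by simp
  have "ennreal (sqrt (2 / pi) * 2) =
      \<bar>r\<bar> * (\<integral>\<^sup>+x. ennreal (std_normal_density (0 + r * x) * \<bar>0 + r * x\<bar> ^ 3) \<partial>lborel)"
    unfolding a3[symmetric] nn_integral_gauss_abs_moment[symmetric]
    using r by (intro nn_integral_real_affine) auto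
  also have "\<dots> = (\<integral>\<^sup>+x. ennreal r * ennreal (std_normal_density (0 + r * x) * \<bar>0 + r * x\<bar> ^ 3) \<partial>lborel)"
    using r by (subst nn_integral_cmult) auto
  also have "\<dots> = (\<integral>\<^sup>+x. ennreal d * ennreal (\<bar>x\<bar> ^ 3 * exp (- x\<^sup>2 * (1 + z\<^sup>2) / 2)) \<partial>lborel)"
  proof (rule nn_integral_cong)
    fix x :: real
    have "r * (std_normal_density (0 + r * x) * \<bar>0 + r * x\<bar> ^ 3) = d * (\<bar>x\<bar> ^ 3 * exp (- x\<^sup>2 * (1 + z\<^sup>2) / 2))"
      using r(1) unfolding r(2)[symmetric]
      by (simp add: normal_density_def d_def abs_mult power_mult_distrib mult_ac power4_eq_xxxx power3_eq_cube)
    then show "ennreal r * ennreal (std_normal_density (0 + r * x) * \<bar>0 + r * x\<bar> ^ 3) =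
        ennreal d * ennreal (\<bar>x\<bar> ^ 3 * exp (- x\<^sup>2 * (1 + z\<^sup>2) / 2))"
      using r d by (simp add: ennreal_mult'[symmetric])
  qed
  also have "\<dots> = ennreal d * ?I" by (rule nn_integral_cmult) measurable
  finally have "ennreal d * ?I = ennreal (sqrt (2 / pi) * 2)" ..
  also have "sqrt (2 / pi) * 2 = d * (4 / (1 + z\<^sup>2)\<^sup>2)"
  proof -
    have "(1 + z\<^sup>2)\<^sup>2 = r ^ 4" by (simp add: r(2)[symmetric] power_mult[symmetric])
    moreover have "sqrt (2 / pi) * sqrt (2 * pi) = 2"
      by (simp add: real_sqrt_mult[symmetric])
    ultimately show ?thesis
      using r(1) by (simp add: d_def field_simps)
  qed
  also have "ennreal (d * (4 / (1 + z\<^sup>2)\<^sup>2)) = ennreal d * ennreal (4 / (1 + z\<^sup>2)\<^sup>2)"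
    using d by (intro ennreal_mult') simp
  finally show ?thesis using d by (subst (asm) ennreal_mult_cancel_left) auto
qed

text \<open>
  The substitution \<open>y = x z\<close> turns the Gaussian weight into \<open>exp(-x\<^sup>2 (1 + z\<^sup>2) / 2)\<close> and makes the integrand
  a product of \<open>\<bar>x\<bar>\<^sup>3\<close> and \<open>\<bar>t + s z\<bar>\<close>; the integral over \<open>x\<close> can then be done first.
\<close>

lemma nn_integral_gauss_abs_product:
  fixes t s :: real
  shows "(\<integral>\<^sup>+x. \<integral>\<^sup>+y. ennreal (\<bar>x\<bar> * \<bar>t * x + s * y\<bar>) * ennreal (std_normal_density x * std_normal_density y) \<partial>lborel \<partial>lborel) =
    ennreal (2 / pi) * (\<integral>\<^sup>+z. ennreal (\<bar>t + s * z\<bar> / (1 + z\<^sup>2)\<^sup>2) \<partial>lborel)"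
proof -
  let ?\<phi> = std_normal_density
  let ?w = "\<lambda>x z. ennreal (\<bar>t + s * z\<bar> / (2 * pi)) * ennreal (\<bar>x\<bar> ^ 3 * exp (- x\<^sup>2 * (1 + z\<^sup>2) / 2))"
  have "(\<integral>\<^sup>+x. \<integral>\<^sup>+y. ennreal (\<bar>x\<bar> * \<bar>t * x + s * y\<bar>) * ennreal (?\<phi> x * ?\<phi> y) \<partial>lborel \<partial>lborel) =
      (\<integral>\<^sup>+x. \<integral>\<^sup>+z. ?w x z \<partial>lborel \<partial>lborel)"
    using AE_lborel_singleton[of "0::real"]
  proof (intro nn_integral_cong_AE, eventually_elim)
    fix x :: real assume x: "x \<noteq> 0"
    have "(\<integral>\<^sup>+y. ennreal (\<bar>x\<bar> * \<bar>t * x + s * y\<bar>) * ennreal (?\<phi> x * ?\<phi> y) \<partial>lborel) =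
        \<bar>x\<bar> * (\<integral>\<^sup>+z. ennreal (\<bar>x\<bar> * \<bar>t * x + s * (0 + x * z)\<bar>) * ennreal (?\<phi> x * ?\<phi> (0 + x * z)) \<partial>lborel)"
      by (rule nn_integral_real_affine[OF _ x]) measurable
    also have "\<dots> = (\<integral>\<^sup>+z. ennreal \<bar>x\<bar> * (ennreal (\<bar>x\<bar> * \<bar>t * x + s * (0 + x * z)\<bar>) * ennreal (?\<phi> x * ?\<phi> (0 + x * z))) \<partial>lborel)"
      by (rule nn_integral_cmult[symmetric]) measurable
    also have "\<dots> = (\<integral>\<^sup>+z. ?w x z \<partial>lborel)"
    proof (rule nn_integral_cong)
      fix z :: real
      have "?\<phi> x * ?\<phi> (x * z) = exp (- x\<^sup>2 * (1 + z\<^sup>2) / 2) / (2 * pi)"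
        by (simp add: normal_density_def exp_add[symmetric] field_simps)
      moreover have "\<bar>t * x + s * (x * z)\<bar> = \<bar>x\<bar> * \<bar>t + s * z\<bar>"
        by (simp add: abs_mult[symmetric] algebra_simps)
      ultimately have "\<bar>x\<bar> * (\<bar>x\<bar> * \<bar>t * x + s * (x * z)\<bar> * (?\<phi> x * ?\<phi> (x * z))) =
          (\<bar>t + s * z\<bar> / (2 * pi)) * (\<bar>x\<bar> ^ 3 * exp (- x\<^sup>2 * (1 + z\<^sup>2) / 2))"
        by (simp add: power3_eq_cube)
      then show "ennreal \<bar>x\<bar> * (ennreal (\<bar>x\<bar> * \<bar>t * x + s * (0 + x * z)\<bar>) * ennreal (?\<phi> x * ?\<phi> (0 + x * z))) = ?w x z"
        by (simp add: ennreal_mult'[symmetric])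
    qed
    finally show "(\<integral>\<^sup>+y. ennreal (\<bar>x\<bar> * \<bar>t * x + s * y\<bar>) * ennreal (?\<phi> x * ?\<phi> y) \<partial>lborel) = (\<integral>\<^sup>+z. ?w x z \<partial>lborel)" .
  qed
  also have "\<dots> = (\<integral>\<^sup>+z. \<integral>\<^sup>+x. ?w x z \<partial>lborel \<partial>lborel)"
    by (rule lborel_pair.Fubini') measurable
  also have "\<dots> = (\<integral>\<^sup>+z. ennreal (2 / pi) * ennreal (\<bar>t + s * z\<bar> / (1 + z\<^sup>2)\<^sup>2) \<partial>lborel)"
  proof (rule nn_integral_cong)
    fix z :: real
    have "(\<integral>\<^sup>+x. ?w x z \<partial>lborel) = ennreal (\<bar>t + s * z\<bar> / (2 * pi)) * ennreal (4 / (1 + z\<^sup>2)\<^sup>2)"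
      unfolding nn_integral_cube_gaussian[symmetric] by (rule nn_integral_cmult) measurable
    then show "(\<integral>\<^sup>+x. ?w x z \<partial>lborel) = ennreal (2 / pi) * ennreal (\<bar>t + s * z\<bar> / (1 + z\<^sup>2)\<^sup>2)"
      by (simp add: ennreal_mult'[symmetric])
  qed
  also have "\<dots> = ennreal (2 / pi) * (\<integral>\<^sup>+z. ennreal (\<bar>t + s * z\<bar> / (1 + z\<^sup>2)\<^sup>2) \<partial>lborel)"
    by (rule nn_integral_cmult) measurable
  finally show ?thesis .
qed

lemma one_plus_square_pos: "1 + (z::real)\<^sup>2 > 0" by (simp add: add_pos_nonneg)

text \<open>
  The antiderivative \<open>F\<close> is explicit, and \<open>-t/s\<close> is the sign change of \<open>t + s z\<close>. Nonnegativity of the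
  value is needed when two such halves are added, and holds because \<open>F\<close> increases on the half-line.
\<close>

lemma kernel_half_integral:
  fixes t s :: real
  assumes s: "s > 0" and ts: "t\<^sup>2 + s\<^sup>2 = 1"
  defines "v \<equiv> t * pi / 4 + s / 2 + t * arctan (t / s) / 2"
  shows "(\<integral>\<^sup>+z. ennreal (\<bar>t + s * z\<bar> / (1 + z\<^sup>2)\<^sup>2) * indicator {- (t / s)..} z \<partial>lborel) = ennreal v"
    and "v \<ge> 0"
proof -
  define F where "F z = t * (z / (1 + z\<^sup>2) + arctan z) / 2 - s / (2 * (1 + z\<^sup>2))" for z
  let ?f = "\<lambda>z. (t + s * z) / (1 + z\<^sup>2)\<^sup>2"
  have deriv: "(F has_real_derivative ?f z) (at z)" for z
  proof -
    have nz: "1 + z\<^sup>2 \<noteq> 0" using one_plus_square_pos[of z] by simp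
    have d1: "((\<lambda>z. z / (1 + z\<^sup>2)) has_real_derivative (1 - z\<^sup>2) / (1 + z\<^sup>2)\<^sup>2) (at z)"
      using nz by (auto intro!: derivative_eq_intros simp: power2_eq_square)
    have d2: "((\<lambda>z. s / (2 * (1 + z\<^sup>2))) has_real_derivative - (s * z) / (1 + z\<^sup>2)\<^sup>2) (at z)"
    proof -
      have "((\<lambda>z. s / (2 * (1 + z\<^sup>2))) has_real_derivative - (s * (4 * z)) / (2 * (1 + z\<^sup>2))\<^sup>2) (at z)"
        using nz by (auto intro!: derivative_eq_intros simp: power2_eq_square)
      moreover have "- (s * (4 * z)) / (2 * (1 + z\<^sup>2))\<^sup>2 = - (s * z) / (1 + z\<^sup>2)\<^sup>2"
        unfolding power_mult_distrib by simp
      ultimately show ?thesis by (rule DERIV_cong)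
    qed
    have "t * ((1 - z\<^sup>2) / (1 + z\<^sup>2)\<^sup>2 + inverse (1 + z\<^sup>2)) / 2 - - (s * z) / (1 + z\<^sup>2)\<^sup>2 = ?f z"
    proof -
      have "inverse (1 + z\<^sup>2) = (1 + z\<^sup>2) / (1 + z\<^sup>2)\<^sup>2"
        using nz by (simp add: power2_eq_square[of "1 + z\<^sup>2"] inverse_eq_divide)
      then have "(1 - z\<^sup>2) / (1 + z\<^sup>2)\<^sup>2 + inverse (1 + z\<^sup>2) = 2 / (1 + z\<^sup>2)\<^sup>2"
        by (simp add: add_divide_distrib[symmetric])
      then show ?thesis by (simp add: add_divide_distrib)
    qed
    then show ?thesis
      unfolding F_def
      using DERIV_diff[OF DERIV_cdivide[OF DERIV_cmult[OF DERIV_add[OF d1 DERIV_arctan], of t], of 2] d2]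
      by simp
  qed
  have nonneg: "t + s * z \<ge> 0" if "z \<ge> - (t / s)" for z
    using that s by (simp add: field_simps)
  have "(F \<longlongrightarrow> t * (0 + pi / 2) / 2 - 0) at_top"
    unfolding F_def
  proof (intro tendsto_intros)
    show "((\<lambda>z::real. z / (1 + z\<^sup>2)) \<longlongrightarrow> 0) at_top" by real_asymp
    show "((\<lambda>z. s / (2 * (1 + z\<^sup>2))) \<longlongrightarrow> 0) at_top" by real_asymp
    show "(arctan \<longlongrightarrow> pi / 2) at_top" by (rule tendsto_arctan_at_top)
  qed simp
  then have lim: "(F \<longlongrightarrow> t * pi / 4) at_top" by simp
  have F: "F (- (t / s)) = - s / 2 - t * arctan (t / s) / 2"
  proof -
    have "1 + (- (t / s))\<^sup>2 = 1 / s\<^sup>2" using s ts by (simp add: field_simps)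
    then have "F (- (t / s)) = t * (- (t / s) * s\<^sup>2 - arctan (t / s)) / 2 - s * s\<^sup>2 / 2"
      by (simp add: F_def arctan_minus)
    also have "\<dots> = - s * (t\<^sup>2 + s\<^sup>2) / 2 - t * arctan (t / s) / 2"
      using s by (simp add: field_simps power2_eq_square)
    finally show ?thesis by (simp add: ts)
  qed
  then have v: "t * pi / 4 - F (- (t / s)) = v" by (simp add: v_def)
  have "(\<integral>\<^sup>+z. ennreal (?f z) * indicator {- (t / s)..} z \<partial>lborel) = t * pi / 4 - F (- (t / s))"
    using deriv nonneg lim by (intro nn_integral_FTC_atLeast) auto
  moreover have "(\<integral>\<^sup>+z. ennreal (\<bar>t + s * z\<bar> / (1 + z\<^sup>2)\<^sup>2) * indicator {- (t / s)..} z \<partial>lborel) =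
      (\<integral>\<^sup>+z. ennreal (?f z) * indicator {- (t / s)..} z \<partial>lborel)"
    using nonneg by (intro nn_integral_cong) (auto simp: indicator_def)
  ultimately show "(\<integral>\<^sup>+z. ennreal (\<bar>t + s * z\<bar> / (1 + z\<^sup>2)\<^sup>2) * indicator {- (t / s)..} z \<partial>lborel) = ennreal v"
    by (simp add: v)
  have "F (- (t / s)) \<le> F z" if "z \<ge> - (t / s)" for z
    using that
  proof (rule DERIV_nonneg_imp_nondecreasing)
    fix u assume "- (t / s) \<le> u"
    then show "\<exists>y. (F has_real_derivative y) (at u) \<and> y \<ge> 0"
      using deriv[of u] nonneg[of u] by (intro exI[of _ "?f u"]) auto
  qed
  then have "F (- (t / s)) \<le> t * pi / 4"
    by (intro tendsto_lowerbound[OF lim]) (auto intro: eventually_mono[OF eventually_ge_at_top[of "- (t / s)"]])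
  then show "v \<ge> 0" using v by linarith
qed

text \<open>
  The reflection \<open>z \<mapsto> -z\<close> turns the half-line on which \<open>t + s z\<close> is negative into the half-line of
  \<open>kernel_half_integral\<close> for \<open>-t\<close>.
\<close>

lemma kernel_integral:
  fixes t s :: real
  assumes s: "s > 0" and ts: "t\<^sup>2 + s\<^sup>2 = 1"
  shows "(\<integral>\<^sup>+z. ennreal (\<bar>t + s * z\<bar> / (1 + z\<^sup>2)\<^sup>2) \<partial>lborel) = ennreal (s + t * arctan (t / s))"
proof -
  let ?f = "\<lambda>t z. ennreal (\<bar>t + s * z\<bar> / (1 + z\<^sup>2)\<^sup>2)"
  have ts': "(- t)\<^sup>2 + s\<^sup>2 = 1" using ts by simp
  have refl: "?f t (- z) = ?f (- t) z" for z
    using abs_minus_cancel[of "- t + s * z"] by simp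
  have "(\<integral>\<^sup>+z. ?f t z \<partial>lborel) = (\<integral>\<^sup>+z. ?f t z * indicator {- (t / s)..} z \<partial>lborel) +
      (\<integral>\<^sup>+z. ?f t (- z) * indicator {- (- (t / s))..} z \<partial>lborel)"
    by (rule nn_integral_split_reflect) measurable
  also have "\<dots> = (\<integral>\<^sup>+z. ?f t z * indicator {- (t / s)..} z \<partial>lborel) +
      (\<integral>\<^sup>+z. ?f (- t) z * indicator {- (- t / s)..} z \<partial>lborel)"
    by (simp only: refl) simp
  also have "\<dots> = ennreal (s + t * arctan (t / s))"
    using kernel_half_integral[OF s ts] kernel_half_integral[OF s ts']
    by (simp add: ennreal_plus[symmetric] arctan_minus field_simps del: ennreal_plus)
  finally show ?thesis .
qed

lemma nn_integral_inverse_one_plus_square: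
  "(\<integral>\<^sup>+z. ennreal (1 / (1 + z\<^sup>2)) \<partial>lborel) = ennreal pi"
proof -
  have half: "(\<integral>\<^sup>+z. ennreal (1 / (1 + z\<^sup>2)) * indicator {0..} z \<partial>lborel) = ennreal (pi / 2 - arctan 0)"
  proof (rule nn_integral_FTC_atLeast)
    show "(arctan has_real_derivative 1 / (1 + z\<^sup>2)) (at z)" for z
      using DERIV_arctan[of z] by (simp add: inverse_eq_divide)
  qed (auto intro: tendsto_arctan_at_top)
  have "(\<integral>\<^sup>+z. ennreal (1 / (1 + z\<^sup>2)) \<partial>lborel) = ennreal (pi / 2 - arctan 0) + ennreal (pi / 2 - arctan 0)"
    using nn_integral_split_reflect[of "\<lambda>z. ennreal (1 / (1 + z\<^sup>2))" 0]
    unfolding power2_minus minus_zero half by measurable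
  also have "\<dots> = ennreal (pi / 2 + pi / 2)"
    by (subst ennreal_plus[symmetric]) simp_all
  finally show ?thesis by simp
qed

text \<open>
  For \<open>t\<^sup>2 \<le> 1/2\<close> the integral is \<open>s + t arcsin t\<close> and the Taylor bound applies. For larger \<open>t\<close> the
  crude estimate \<open>\<bar>t + s z\<bar> \<le> 1 + \<bar>z\<bar> \<le> (5/4)(1 + z\<^sup>2)\<close> gives \<open>5\<pi>/4 < 4\<close>, and \<open>1 + 24 t\<^sup>6 \<ge> 4\<close>; this
  is what fixes the constant \<open>24\<close>.
\<close>

lemma kernel_integral_bound:
  fixes t s :: real
  assumes s: "s \<ge> 0" and ts: "t\<^sup>2 + s\<^sup>2 = 1"
  shows "(\<integral>\<^sup>+z. ennreal (\<bar>t + s * z\<bar> / (1 + z\<^sup>2)\<^sup>2) \<partial>lborel) \<le> ennreal (1 + t\<^sup>2 / 2 + t ^ 4 / 24 + 24 * t ^ 6)"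
proof (cases "t\<^sup>2 \<le> 1/2")
  case True
  have s': "s = sqrt (1 - t\<^sup>2)" using s ts by (intro real_sqrt_unique[symmetric]) auto
  have "s > 0" using True by (simp add: s')
  have "\<bar>t\<bar> < 1" by (rule power2_less_imp_less[of _ 1]) (use True in auto)
  then have "t * arctan (t / s) = t * arcsin t"
    by (simp add: arcsin_arctan s')
  also have "\<dots> = \<bar>t\<bar> * arcsin \<bar>t\<bar>"
    using \<open>\<bar>t\<bar> < 1\<close> by (auto simp: abs_if arcsin_minus)
  finally have "s + t * arctan (t / s) \<le> 1 + t\<^sup>2 / 2 + t ^ 4 / 24 + t ^ 6 / 30"
    using kernel_upper_bound[of "\<bar>t\<bar>"] True s' by (simp add: power_even_abs)
  also have "\<dots> \<le> 1 + t\<^sup>2 / 2 + t ^ 4 / 24 + 24 * t ^ 6"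
    using zero_le_even_power[of 6 t] by (simp add: field_simps)
  finally show ?thesis
    unfolding kernel_integral[OF \<open>s > 0\<close> ts] by (rule ennreal_leI)
next
  case False
  have abs_le: "\<bar>t\<bar> \<le> 1" "s \<le> 1"
  proof -
    have "t\<^sup>2 \<le> 1\<^sup>2" "s\<^sup>2 \<le> 1\<^sup>2"
      using ts zero_le_power2[of t] zero_le_power2[of s] unfolding power_one by linarith+
    then show "\<bar>t\<bar> \<le> 1" "s \<le> 1"
      using abs_le_square_iff[of t 1] power2_le_imp_le[of s 1] by auto
  qed
  have "(\<integral>\<^sup>+z. ennreal (\<bar>t + s * z\<bar> / (1 + z\<^sup>2)\<^sup>2) \<partial>lborel) \<le> (\<integral>\<^sup>+z. ennreal (5/4) * ennreal (1 / (1 + z\<^sup>2)) \<partial>lborel)"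
  proof (rule nn_integral_mono)
    fix z :: real
    have "\<bar>t + s * z\<bar> \<le> \<bar>t\<bar> + \<bar>s * z\<bar>" by (rule abs_triangle_ineq)
    also have "\<dots> \<le> 1 + 1 * \<bar>z\<bar>"
      unfolding abs_mult using abs_le s by (intro add_mono mult_right_mono) auto
    also have "\<dots> \<le> 5/4 * (1 + z\<^sup>2)"
    proof -
      have "0 \<le> (\<bar>z\<bar> - 1/2)\<^sup>2" by simp
      then have "\<bar>z\<bar> \<le> 1/4 + z\<^sup>2" by (simp add: power2_diff power_divide)
      then show ?thesis using zero_le_power2[of z] unfolding distrib_left by linarith
    qed
    finally have "\<bar>t + s * z\<bar> / (1 + z\<^sup>2)\<^sup>2 \<le> 5/4 * (1 + z\<^sup>2) / (1 + z\<^sup>2)\<^sup>2"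
      by (rule divide_right_mono) simp
    also have "\<dots> = 5/4 * (1 / (1 + z\<^sup>2))"
    proof -
      have "c * A / A\<^sup>2 = c * (1 / A)" if "A > 0" for A c :: real
        using that by (simp add: power2_eq_square)
      then show ?thesis using one_plus_square_pos[of z] by blast
    qed
    finally show "ennreal (\<bar>t + s * z\<bar> / (1 + z\<^sup>2)\<^sup>2) \<le> ennreal (5/4) * ennreal (1 / (1 + z\<^sup>2))"
      by (subst ennreal_mult'[symmetric]) (auto intro: ennreal_leI)
  qed
  also have "\<dots> = ennreal (5/4) * ennreal pi"
    by (subst nn_integral_cmult) (simp_all only: nn_integral_inverse_one_plus_square, measurable)
  also have "\<dots> = ennreal (5/4 * pi)" by (rule ennreal_mult'[symmetric]) simp
  also have "\<dots> \<le> ennreal (1 + t\<^sup>2 / 2 + t ^ 4 / 24 + 24 * t ^ 6)"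
  proof (rule ennreal_leI)
    have "(1/2)^3 \<le> (t\<^sup>2)^3" using False by (intro power_mono) auto
    then have "24 * t ^ 6 \<ge> 3" by (simp add: power_mult[symmetric] power3_eq_cube)
    have "pi \<le> 3.2" using pi_approx by simp
    show "5/4 * pi \<le> 1 + t\<^sup>2 / 2 + t ^ 4 / 24 + 24 * t ^ 6"
    proof -
      have "0 \<le> t\<^sup>2" "0 \<le> t ^ 4" by simp_all
      with \<open>24 * t ^ 6 \<ge> 3\<close> \<open>pi \<le> 3.2\<close> show ?thesis by linarith
    qed
  qed
  finally show ?thesis .
qed

section \<open>Rotating two directions into a coordinate plane\<close>

lemma dot_cong: "(\<And>i. i < n \<Longrightarrow> x i = x' i) \<Longrightarrow> (\<And>i. i < n \<Longrightarrow> y i = y' i) \<Longrightarrow> dot n x y = dot n x' y'"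
  by (simp add: dot_def)

lemma dot_commute: "dot n x y = dot n y x"
  by (simp add: dot_def mult.commute)

lemma dot_self: "dot n x x = (nrm n x)\<^sup>2"
  by (simp add: dot_def L2_set_def sum_nonneg power2_eq_square)

lemma abs_dot_le: "\<bar>dot n x y\<bar> \<le> nrm n x * nrm n y"
  unfolding dot_def using L2_set_mult_ineq[of x y "{..<n}"] sum_abs[of "\<lambda>i. x i * y i" "{..<n}"]
  by (simp add: abs_mult)

lemma measurable_dot [measurable (raw)]:
  assumes [measurable]: "f \<in> M \<rightarrow>\<^sub>M borel_Rn n" "g \<in> M \<rightarrow>\<^sub>M borel_Rn n"
  shows "(\<lambda>x. dot n (f x) (g x)) \<in> borel_measurable M"
  unfolding dot_def by measurable

lemma dot_mat_app:
  assumes "orthogonal_mat n U"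
  shows "dot n (mat_app n U x) (mat_app n U y) = dot n x y"
proof -
  have "dot n (mat_app n U x) (mat_app n U y) = (\<Sum>i<n. \<Sum>j<n. \<Sum>k<n. (U i j * U i k) * (x j * y k))"
    by (simp add: dot_def mat_app_def sum_product algebra_simps)
  also have "\<dots> = (\<Sum>j<n. \<Sum>k<n. \<Sum>i<n. (U i j * U i k) * (x j * y k))"
    by (subst sum.swap) (intro sum.cong refl sum.swap)
  also have "\<dots> = (\<Sum>j<n. \<Sum>k<n. (\<Sum>i<n. U i j * U i k) * (x j * y k))"
    by (simp add: sum_distrib_right)
  also have "\<dots> = (\<Sum>j<n. \<Sum>k<n. (if j = k then 1 else 0) * (x j * y k))"
    using assms by (intro sum.cong) (auto simp: orthogonal_mat_def)
  also have "\<dots> = dot n x y"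
    by (simp add: if_distrib[of "\<lambda>t. t * _"] dot_def cong: if_cong)
  finally show ?thesis .
qed

text \<open>
  Equal lengths make \<open>u + v\<close> orthogonal to \<open>u - v\<close>, so the reflection in the hyperplane orthogonal to
  \<open>u - v\<close> exchanges \<open>u\<close> and \<open>v\<close>; it fixes every vector that has the same inner product with both.
\<close>

lemma householder:
  assumes "nrm n u = nrm n v"
  obtains U where "orthogonal_mat n U" and "\<And>i. i < n \<Longrightarrow> mat_app n U u i = v i"
    and "\<And>z i. dot n z u = dot n z v \<Longrightarrow> i < n \<Longrightarrow> mat_app n U z i = z i"
proof -
  define w where "w i = u i - v i" for i
  define W where "W = dot n w w"
  \<comment> \<open>If \<open>w = 0\<close> then \<open>W = 0\<close> and the quotient below is \<open>0\<close>, so that \<open>U\<close> is the identity.\<close>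
  define U where "U i j = (if i = j then 1 else 0) - 2 * w i * w j / W" for i j
  have app: "mat_app n U z i = z i - 2 * w i * dot n z w / W" if "i < n" for z i
  proof -
    have "mat_app n U z i = (\<Sum>j<n. (if i = j then z j else 0) - 2 * w i / W * (z j * w j))"
      using that unfolding mat_app_def U_def by (auto intro!: sum.cong simp: algebra_simps)
    also have "\<dots> = z i - 2 * w i / W * dot n z w"
      using that by (simp add: sum_subtractf sum_distrib_left sum_divide_distrib dot_def)
    finally show ?thesis by simp
  qed
  have UU: "(\<Sum>k<n. U i k * U j k) = (if i = j then 1 else 0)" if ij: "i < n" "j < n" for i j
  proof -
    have "(\<Sum>k<n. U i k * U j k) = mat_app n U (U j) i"
      using ij by (simp add: mat_app_def)
    also have "\<dots> = U j i - 2 * w i * dot n (U j) w / W" by (rule app[OF ij(1)])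
    also have "dot n (U j) w = mat_app n U w j"
      using ij by (simp add: mat_app_def dot_def)
    also have "\<dots> = w j - 2 * w j * dot n w w / W" by (rule app[OF ij(2)])
    also have "U j i - 2 * w i * (w j - 2 * w j * dot n w w / W) / W = (if i = j then 1 else 0)"
      by (cases "W = 0") (auto simp: U_def W_def[symmetric])
    finally show ?thesis .
  qed
  have sym: "U i j = U j i" for i j by (simp add: U_def)
  have orth: "orthogonal_mat n U"
    unfolding orthogonal_mat_def using UU sym by simp
  have dot_w: "dot n z w = dot n z u - dot n z v" for z
    by (simp add: dot_def w_def right_diff_distrib sum_subtractf)
  have "W = 2 * dot n u w"
  proof -
    have "W = dot n u w - dot n v w"
      by (simp add: W_def dot_def w_def left_diff_distrib sum_subtractf)
    also have "\<dots> = dot n u u - dot n u v - (dot n v u - dot n v v)" by (simp add: dot_w)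
    also have "\<dots> = 2 * (dot n u u - dot n u v)"
      using assms by (simp add: dot_self dot_commute[of n v u])
    finally show ?thesis by (simp add: dot_w)
  qed
  have "mat_app n U u i = v i" if i: "i < n" for i
  proof (cases "W = 0")
    case True
    then have "nrm n w = 0" by (simp add: W_def dot_self)
    then have "w i = 0" using i by (simp add: L2_set_eq_0_iff)
    then show ?thesis using i by (simp add: app w_def)
  next
    case False
    then show ?thesis
      using i \<open>W = 2 * dot n u w\<close> by (simp add: app field_simps) (simp add: w_def)
  qed
  moreover have "mat_app n U z i = z i" if "dot n z u = dot n z v" "i < n" for z i
    using that by (simp add: app dot_w)
  ultimately show ?thesis using that orth by blast
qed

lemma space_sphere_measure: "space (sphere_measure n) = unit_sphere n"
  by (auto simp: sphere_measure_def space_restrict_space unit_sphere_def)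

lemma measurable_sphere_measure: "f \<in> borel_Rn n \<rightarrow>\<^sub>M N \<Longrightarrow> f \<in> sphere_measure n \<rightarrow>\<^sub>M N"
  unfolding sphere_measure_def by (intro measurable_restrict_space1) simp

lemma measurable_ident_sphere_measure: "(\<lambda>\<theta>. \<theta>) \<in> sphere_measure n \<rightarrow>\<^sub>M borel_Rn n"
  by (rule measurable_sphere_measure) simp

lemma nn_integral_sphere_rotate:
  assumes U: "orthogonal_mat n U" and g [measurable]: "g \<in> borel_measurable (borel_Rn n)"
  shows "(\<integral>\<^sup>+\<theta>. g (mat_app n U \<theta>) \<partial>sphere_measure n) = (\<integral>\<^sup>+\<theta>. g \<theta> \<partial>sphere_measure n)"
proof -
  have "mat_app n U \<theta> \<in> unit_sphere n" if "\<theta> \<in> unit_sphere n" for \<theta>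
    using that nrm_mat_app[OF U, of \<theta>] by (auto simp: unit_sphere_def mat_app_def space_PiM)
  then have meas: "mat_app n U \<in> sphere_measure n \<rightarrow>\<^sub>M sphere_measure n"
    unfolding sphere_measure_def by (intro measurable_restrict_space3) auto
  have "(\<integral>\<^sup>+\<theta>. g \<theta> \<partial>sphere_measure n) =
      (\<integral>\<^sup>+\<theta>. g \<theta> \<partial>distr (sphere_measure n) (sphere_measure n) (mat_app n U))"
    by (simp add: sphere_measure_orthogonal[OF U])
  also have "\<dots> = (\<integral>\<^sup>+\<theta>. g (mat_app n U \<theta>) \<partial>sphere_measure n)"
    by (rule nn_integral_distr[OF meas]) (simp add: measurable_sphere_measure)
  finally show ?thesis ..
qed

lemma measurable_dot_const [measurable]: "(\<lambda>\<theta>. dot n \<theta> u) \<in> borel_measurable (borel_Rn n)"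
  unfolding dot_def by measurable

definition sphere_kernel :: "nat \<Rightarrow> (nat \<Rightarrow> real) \<Rightarrow> (nat \<Rightarrow> real) \<Rightarrow> ennreal" where
  "sphere_kernel n u v = (\<integral>\<^sup>+\<theta>. ennreal (\<bar>dot n \<theta> u\<bar> * \<bar>dot n \<theta> v\<bar>) \<partial>sphere_measure n)"

lemma sphere_kernel_cong:
  "(\<And>i. i < n \<Longrightarrow> u i = u' i) \<Longrightarrow> (\<And>i. i < n \<Longrightarrow> v i = v' i) \<Longrightarrow> sphere_kernel n u v = sphere_kernel n u' v'"
  unfolding sphere_kernel_def
  by (intro nn_integral_cong arg_cong[where f=ennreal] arg_cong2[where f="(*)"] arg_cong[where f=abs] dot_cong) auto

lemma sphere_kernel_rotate:
  assumes U: "orthogonal_mat n U"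
  shows "sphere_kernel n (mat_app n U u) (mat_app n U v) = sphere_kernel n u v"
proof -
  have "sphere_kernel n (mat_app n U u) (mat_app n U v) =
      (\<integral>\<^sup>+\<theta>. ennreal (\<bar>dot n (mat_app n U \<theta>) (mat_app n U u)\<bar> * \<bar>dot n (mat_app n U \<theta>) (mat_app n U v)\<bar>) \<partial>sphere_measure n)"
    unfolding sphere_kernel_def by (rule nn_integral_sphere_rotate[OF U, symmetric]) measurable
  then show ?thesis by (simp add: dot_mat_app[OF U] sphere_kernel_def)
qed

definition axis0 :: "nat \<Rightarrow> real" where
  "axis0 i = (if i = 0 then 1 else 0)"

definition plane_vec :: "real \<Rightarrow> real \<Rightarrow> nat \<Rightarrow> real" where
  "plane_vec t s i = (if i = 0 then t else if i = 1 then s else 0)"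

lemma dot_axis0: "n \<ge> 1 \<Longrightarrow> dot n x axis0 = x 0"
  by (simp add: dot_def axis0_def if_distrib[of "\<lambda>t. _ * t"] cong: if_cong)

lemma dot_plane_vec:
  assumes "n \<ge> 2" shows "dot n x (plane_vec t s) = t * x 0 + s * x 1"
proof -
  have "dot n x (plane_vec t s) = (\<Sum>i<n. (if i = 0 then x 0 * t else 0) + (if i = 1 then x 1 * s else 0))"
    unfolding dot_def by (intro sum.cong) (auto simp: plane_vec_def)
  then show ?thesis using assms by (simp add: sum.distrib mult.commute)
qed

lemma nrm_axis0: "n \<ge> 1 \<Longrightarrow> nrm n axis0 = 1"
  using dot_self[of n axis0] dot_axis0[of n axis0] L2_set_nonneg[of axis0 "{..<n}"]
  by (auto simp: axis0_def power2_eq_1_iff)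

text \<open>
  A reflection takes \<open>u\<close> to the first coordinate vector. A second one takes the image of \<open>v\<close> to a vector of
  the first coordinate plane with the same first coordinate, and therefore fixes the first coordinate vector.
\<close>

lemma sphere_kernel_reduce:
  assumes n: "n \<ge> 2" and u: "nrm n u = 1" and v: "nrm n v = 1"
    and s: "s \<ge> 0" and ts: "(dot n u v)\<^sup>2 + s\<^sup>2 = 1"
  shows "sphere_kernel n u v = sphere_kernel n axis0 (plane_vec (dot n u v) s)"
proof -
  define t where "t = dot n u v"
  have n1: "n \<ge> 1" using n by simp
  obtain U where U: "orthogonal_mat n U" "\<And>i. i < n \<Longrightarrow> mat_app n U u i = axis0 i"
    using householder[of u n axis0] u nrm_axis0[OF n1] by metis
  define v1 where "v1 = mat_app n U v"
  have "dot n v1 axis0 = dot n (mat_app n U v) (mat_app n U u)"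
    unfolding v1_def by (intro dot_cong) (simp_all add: U(2))
  then have v1_axis: "dot n axis0 v1 = t"
    by (simp add: dot_mat_app[OF U(1)] dot_commute t_def)
  have v1_nrm: "nrm n v1 = 1" by (simp add: v1_def nrm_mat_app[OF U(1)] v)
  have "(nrm n (plane_vec t s))\<^sup>2 = 1"
    using n ts by (simp add: dot_self[symmetric] dot_plane_vec) (simp add: plane_vec_def power2_eq_square t_def)
  then have p_nrm: "nrm n (plane_vec t s) = 1"
    using L2_set_nonneg[of "plane_vec t s" "{..<n}"] by (auto simp: power2_eq_1_iff)
  have p_axis: "dot n axis0 (plane_vec t s) = t"
    using n by (simp add: dot_plane_vec axis0_def)
  obtain V where V: "orthogonal_mat n V" "\<And>i. i < n \<Longrightarrow> mat_app n V v1 i = plane_vec t s i"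
    "\<And>z i. dot n z v1 = dot n z (plane_vec t s) \<Longrightarrow> i < n \<Longrightarrow> mat_app n V z i = z i"
    using householder[of v1 n "plane_vec t s"] v1_nrm p_nrm by metis
  have "sphere_kernel n u v = sphere_kernel n (mat_app n U u) v1"
    by (simp add: v1_def sphere_kernel_rotate[OF U(1)])
  also have "\<dots> = sphere_kernel n axis0 v1"
    by (rule sphere_kernel_cong) (simp_all add: U(2))
  also have "\<dots> = sphere_kernel n (mat_app n V axis0) (mat_app n V v1)"
    by (simp add: sphere_kernel_rotate[OF V(1)])
  also have "\<dots> = sphere_kernel n axis0 (plane_vec t s)"
    using V(3)[of axis0] by (intro sphere_kernel_cong) (simp_all add: V(2) v1_axis p_axis)
  finally show ?thesis by (simp add: t_def)
qed

lemma sphere_mean_abs_dot_reduce: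
  assumes n: "n \<ge> 1" and u: "nrm n u = 1"
  shows "(\<integral>\<^sup>+\<theta>. ennreal \<bar>dot n \<theta> u\<bar> \<partial>sphere_measure n) = (\<integral>\<^sup>+\<theta>. ennreal \<bar>dot n \<theta> axis0\<bar> \<partial>sphere_measure n)"
proof -
  obtain U where U: "orthogonal_mat n U" "\<And>i. i < n \<Longrightarrow> mat_app n U u i = axis0 i"
    using householder[of u n axis0] u nrm_axis0[OF n] by metis
  have "(\<integral>\<^sup>+\<theta>. ennreal \<bar>dot n \<theta> axis0\<bar> \<partial>sphere_measure n) =
      (\<integral>\<^sup>+\<theta>. ennreal \<bar>dot n (mat_app n U \<theta>) axis0\<bar> \<partial>sphere_measure n)"
    by (rule nn_integral_sphere_rotate[OF U(1), symmetric]) measurable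
  also have "\<dots> = (\<integral>\<^sup>+\<theta>. ennreal \<bar>dot n (mat_app n U \<theta>) (mat_app n U u)\<bar> \<partial>sphere_measure n)"
    by (intro nn_integral_cong arg_cong[where f=ennreal] arg_cong[where f=abs] dot_cong) (simp_all add: U(2))
  also have "\<dots> = (\<integral>\<^sup>+\<theta>. ennreal \<bar>dot n \<theta> u\<bar> \<partial>sphere_measure n)"
    by (simp add: dot_mat_app[OF U(1)])
  finally show ?thesis ..
qed

section \<open>The absolute-value kernel on the sphere\<close>

lemma abs_component_le_nrm: "i < n \<Longrightarrow> \<bar>x i\<bar> \<le> nrm n x"
  using member_le_L2_set[of "{..<n}" i "\<lambda>i. \<bar>x i\<bar>"] by (simp add: L2_set_def)

lemma sphere_component_le:
  assumes "\<theta> \<in> space (sphere_measure n)" "i < n"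
  shows "\<bar>\<theta> i\<bar> \<le> 1"
  using abs_component_le_nrm[OF assms(2), of \<theta>] assms(1)
  by (simp add: space_sphere_measure unit_sphere_def)

lemma measurable_component_borel_Rn: "i < n \<Longrightarrow> (\<lambda>x. x i) \<in> borel_measurable (borel_Rn n)"
  using measurable_component_singleton[of i "{..<n}" "\<lambda>_. borel"] by simp

lemma nrm_mult_normalize_component: "i < n \<Longrightarrow> nrm n x * normalize_vec n x i = x i"
proof -
  assume i: "i < n"
  show ?thesis
  proof (cases "nrm n x = 0")
    case True
    then have "x i = 0" using i by (simp add: L2_set_eq_0_iff)
    then show ?thesis using True by simp
  qed (use i in \<open>simp add: normalize_vec_def\<close>)
qed

text \<open>
  By homogeneity of degree \<open>1\<close>, \<open>E\<bar>G\<^sub>0\<bar> = E\<bar>G\<bar>\<close> times the sphere average of \<open>\<bar>\<theta>\<^sub>0\<bar>\<close>, and the left-hand side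
  is the first absolute moment \<open>sqrt(2/\<pi>)\<close>.
\<close>

lemma sphere_mean_abs_dot_unit:
  assumes n: "n \<ge> 1" and u: "nrm n u = 1"
  shows "(\<integral>\<^sup>+\<theta>. ennreal \<bar>dot n \<theta> u\<bar> \<partial>sphere_measure n) = ennreal (sqrt (2 / pi) / gauss_mean_norm n)"
proof -
  interpret S: prob_space "sphere_measure n" by (rule prob_space_sphere_measure[OF n])
  let ?E = "\<integral>\<^sup>+\<theta>. ennreal \<bar>\<theta> 0\<bar> \<partial>sphere_measure n"
  have [measurable]: "(\<lambda>x. x 0) \<in> borel_measurable (borel_Rn n)"
    using n by (intro measurable_component_borel_Rn) simp
  have "?E \<le> (\<integral>\<^sup>+\<theta>. ennreal 1 \<partial>sphere_measure n)"
    using n by (intro nn_integral_mono ennreal_leI sphere_component_le) auto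
  then have fin: "?E < \<infinity>" by (simp add: S.emeasure_space_1 order_le_less_trans)
  have "ennreal (gauss_mean_norm n) * ?E =
      (\<integral>\<^sup>+x. ennreal (nrm n x ^ 1) * ennreal \<bar>normalize_vec n x 0\<bar> * ennreal (gauss_density n x) \<partial>lborel_Rn n)"
    using gauss_polar_coordinates[OF n _ fin, of 1] n by (simp add: gauss_mean_norm_def)
  also have "\<dots> = (\<integral>\<^sup>+x. ennreal \<bar>x 0\<bar> * ennreal (\<Prod>i<n. std_normal_density (x i)) \<partial>lborel_Rn n)"
  proof (rule nn_integral_cong)
    fix x :: "nat \<Rightarrow> real"
    have "nrm n x ^ 1 * \<bar>normalize_vec n x 0\<bar> = \<bar>x 0\<bar>"
      using nrm_mult_normalize_component[of 0 n x] n abs_mult[of "nrm n x" "normalize_vec n x 0"] by simp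
    then show "ennreal (nrm n x ^ 1) * ennreal \<bar>normalize_vec n x 0\<bar> * ennreal (gauss_density n x) =
        ennreal \<bar>x 0\<bar> * ennreal (\<Prod>i<n. std_normal_density (x i))"
      by (subst ennreal_mult[symmetric]) (simp_all add: gauss_density_def)
  qed
  also have "\<dots> = (\<integral>\<^sup>+y. ennreal \<bar>y\<bar> * ennreal (std_normal_density y) \<partial>lborel)"
    using n by (intro nn_integral_gauss_coordinate) auto
  also have "\<dots> = ennreal (gauss_abs_moment 1)"
    unfolding nn_integral_gauss_abs_moment[symmetric]
    by (intro nn_integral_cong) (simp add: ennreal_mult'[symmetric] mult.commute)
  also have "gauss_abs_moment 1 = gauss_mean_norm n * (sqrt (2 / pi) / gauss_mean_norm n)"
    using gauss_abs_moment_odd[of 0] gauss_mean_norm_pos[of n] by simp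
  also have "ennreal \<dots> = ennreal (gauss_mean_norm n) * ennreal (sqrt (2 / pi) / gauss_mean_norm n)"
    using gauss_mean_norm_pos[of n] by (intro ennreal_mult') simp
  finally have "?E = ennreal (sqrt (2 / pi) / gauss_mean_norm n)"
    using gauss_mean_norm_pos[of n] by (subst (asm) ennreal_mult_cancel_left) auto
  then show ?thesis
    by (simp add: sphere_mean_abs_dot_reduce[OF n u] dot_axis0[OF n])
qed

text \<open>
  By homogeneity of degree \<open>2\<close>, the Gaussian expectation of \<open>\<bar>G\<^sub>0\<bar> \<bar>t G\<^sub>0 + s G\<^sub>1\<bar>\<close> is \<open>E\<bar>G\<bar>\<^sup>2 = n\<close> times the
  sphere average.
\<close>

lemma sphere_kernel_unit_bound:
  assumes n: "n \<ge> 2" and u: "nrm n u = 1" and v: "nrm n v = 1"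
  defines "t \<equiv> dot n u v"
  shows "sphere_kernel n u v \<le> ennreal (2 / (pi * real n) * (1 + t\<^sup>2 / 2 + t ^ 4 / 24 + 24 * t ^ 6))"
proof -
  have n1: "n \<ge> 1" using n by simp
  interpret S: prob_space "sphere_measure n" by (rule prob_space_sphere_measure[OF n1])
  define s where "s = sqrt (1 - t\<^sup>2)"
  have "\<bar>t\<bar> \<le> 1" using abs_dot_le[of n u v] u v by (simp add: t_def)
  then have "t\<^sup>2 \<le> 1" by (simp add: abs_square_le_1)
  then have s: "s \<ge> 0" "t\<^sup>2 + s\<^sup>2 = 1" by (auto simp: s_def)
  let ?f = "\<lambda>x y. ennreal (\<bar>x\<bar> * \<bar>t * x + s * y\<bar>)"
  let ?E = "\<integral>\<^sup>+\<theta>. ?f (\<theta> 0) (\<theta> 1) \<partial>sphere_measure n"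
  have E: "sphere_kernel n u v = ?E"
    using sphere_kernel_reduce[OF n u v s(1)] s(2) n
    by (simp add: t_def[symmetric] sphere_kernel_def dot_axis0[OF n1] dot_plane_vec)
  have [measurable]: "(\<lambda>x. x 0) \<in> borel_measurable (borel_Rn n)" "(\<lambda>x. x 1) \<in> borel_measurable (borel_Rn n)"
    using n by (auto intro: measurable_component_borel_Rn)
  have "?E \<le> (\<integral>\<^sup>+\<theta>. ennreal (1 * (\<bar>t\<bar> * 1 + s * 1)) \<partial>sphere_measure n)"
  proof (intro nn_integral_mono ennreal_leI mult_mono)
    fix \<theta> assume "\<theta> \<in> space (sphere_measure n)"
    then have *: "\<bar>\<theta> 0\<bar> \<le> 1" "\<bar>\<theta> 1\<bar> \<le> 1" using n by (auto intro: sphere_component_le)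
    then show "\<bar>\<theta> 0\<bar> \<le> 1" by simp
    have "\<bar>t * \<theta> 0 + s * \<theta> 1\<bar> \<le> \<bar>t\<bar> * \<bar>\<theta> 0\<bar> + s * \<bar>\<theta> 1\<bar>"
      using abs_triangle_ineq[of "t * \<theta> 0" "s * \<theta> 1"] s(1) by (simp add: abs_mult)
    also have "\<dots> \<le> \<bar>t\<bar> * 1 + s * 1"
      using * s(1) by (intro add_mono mult_left_mono) auto
    finally show "\<bar>t * \<theta> 0 + s * \<theta> 1\<bar> \<le> \<bar>t\<bar> * 1 + s * 1" .
  qed auto
  also have "\<dots> < \<infinity>" by (simp add: S.emeasure_space_1 ennreal_mult_less_top)
  finally have fin: "?E < \<infinity>" .
  have meas: "(\<lambda>\<theta>. ?f (\<theta> 0) (\<theta> 1)) \<in> borel_measurable (borel_Rn n)" by measurable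
  have rec: "gauss_abs_moment (n - 1 + 2) / gauss_abs_moment (n - 1) = real n"
    using gauss_abs_moment_rec[of "n - 1"] gauss_abs_moment_pos[of "n - 1"] n by simp
  have "ennreal (real n) * ?E =
      (\<integral>\<^sup>+x. ennreal (nrm n x ^ 2) * ?f (normalize_vec n x 0) (normalize_vec n x 1) * ennreal (gauss_density n x) \<partial>lborel_Rn n)"
    using gauss_polar_coordinates[OF n1 meas fin, of 2] unfolding rec by (rule sym)
  also have "\<dots> = (\<integral>\<^sup>+x. ?f (x 0) (x 1) * ennreal (gauss_density n x) \<partial>lborel_Rn n)"
  proof (rule nn_integral_cong)
    fix x :: "nat \<Rightarrow> real"
    let ?a = "normalize_vec n x 0" and ?b = "normalize_vec n x 1" and ?r = "nrm n x"
    have "\<bar>x 0\<bar> * \<bar>t * x 0 + s * x 1\<bar> = \<bar>?r * ?a\<bar> * \<bar>t * (?r * ?a) + s * (?r * ?b)\<bar>"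
      using n by (simp add: nrm_mult_normalize_component)
    also have "\<bar>t * (?r * ?a) + s * (?r * ?b)\<bar> = \<bar>?r * (t * ?a + s * ?b)\<bar>"
      by (simp add: algebra_simps)
    also have "\<bar>?r * ?a\<bar> * \<bar>?r * (t * ?a + s * ?b)\<bar> = ?r ^ 2 * (\<bar>?a\<bar> * \<bar>t * ?a + s * ?b\<bar>)"
      unfolding abs_mult by (simp add: power2_eq_square)
    finally have "?r ^ 2 * (\<bar>?a\<bar> * \<bar>t * ?a + s * ?b\<bar>) = \<bar>x 0\<bar> * \<bar>t * x 0 + s * x 1\<bar>" ..
    then show "ennreal (nrm n x ^ 2) * ?f ?a ?b * ennreal (gauss_density n x) = ?f (x 0) (x 1) * ennreal (gauss_density n x)"
      by (subst ennreal_mult[symmetric]) simp_all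
  qed
  also have "\<dots> = (\<integral>\<^sup>+x. \<integral>\<^sup>+y. ?f x y * ennreal (std_normal_density x * std_normal_density y) \<partial>lborel \<partial>lborel)"
    by (rule nn_integral_gauss_two_coordinates[OF n]) measurable
  also have "\<dots> = ennreal (2 / pi) * (\<integral>\<^sup>+z. ennreal (\<bar>t + s * z\<bar> / (1 + z\<^sup>2)\<^sup>2) \<partial>lborel)"
    by (rule nn_integral_gauss_abs_product)
  also have "\<dots> \<le> ennreal (2 / pi) * ennreal (1 + t\<^sup>2 / 2 + t ^ 4 / 24 + 24 * t ^ 6)"
    by (intro mult_left_mono kernel_integral_bound s) simp
  also have "\<dots> = ennreal (2 / pi * (1 + t\<^sup>2 / 2 + t ^ 4 / 24 + 24 * t ^ 6))"
    by (rule ennreal_mult'[symmetric]) simp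
  also have "2 / pi * (1 + t\<^sup>2 / 2 + t ^ 4 / 24 + 24 * t ^ 6) =
      real n * (2 / (pi * real n) * (1 + t\<^sup>2 / 2 + t ^ 4 / 24 + 24 * t ^ 6))"
    using n by simp
  also have "ennreal \<dots> = ennreal (real n) * ennreal (2 / (pi * real n) * (1 + t\<^sup>2 / 2 + t ^ 4 / 24 + 24 * t ^ 6))"
    by (rule ennreal_mult') simp
  finally show ?thesis
    unfolding E using n by (subst (asm) ennreal_mult_le_mult_iff) auto
qed

lemma dot_scale_left: "dot n (\<lambda>i. c * x i) y = c * dot n x y"
  by (simp add: dot_def sum_distrib_left mult.assoc)

lemma unit_direction:
  assumes "nrm n x \<noteq> 0"
  obtains u where "nrm n u = 1" and "\<And>y. dot n y x = nrm n x * dot n y u"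
proof
  let ?u = "\<lambda>i. inverse (nrm n x) * x i"
  have "nrm n ?u = inverse (nrm n x) * nrm n x"
    by (rule L2_set_right_distrib[symmetric]) simp
  then show "nrm n ?u = 1" using assms by simp
  show "dot n y x = nrm n x * dot n y ?u" for y
    using assms dot_scale_left[of n "inverse (nrm n x)" x y] by (simp add: dot_commute[of n y])
qed

lemma dot_zero: "nrm n x = 0 \<Longrightarrow> dot n y x = 0"
  using abs_dot_le[of n y x] by simp

lemma sphere_mean_abs_dot:
  assumes n: "n \<ge> 1"
  shows "(\<integral>\<^sup>+\<theta>. ennreal \<bar>dot n \<theta> x\<bar> \<partial>sphere_measure n) = ennreal (sqrt (2 / pi) / gauss_mean_norm n * nrm n x)"
proof (cases "nrm n x = 0")
  case True
  then show ?thesis by (simp add: dot_zero)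
next
  case False
  then obtain u where u: "nrm n u = 1" "\<And>y. dot n y x = nrm n x * dot n y u"
    by (metis unit_direction)
  have "(\<integral>\<^sup>+\<theta>. ennreal \<bar>dot n \<theta> x\<bar> \<partial>sphere_measure n) =
      (\<integral>\<^sup>+\<theta>. ennreal (nrm n x) * ennreal \<bar>dot n \<theta> u\<bar> \<partial>sphere_measure n)"
    by (intro nn_integral_cong) (simp add: u(2) abs_mult ennreal_mult')
  also have "\<dots> = ennreal (nrm n x) * (\<integral>\<^sup>+\<theta>. ennreal \<bar>dot n \<theta> u\<bar> \<partial>sphere_measure n)"
    by (rule nn_integral_cmult) (rule measurable_sphere_measure, measurable)
  finally show ?thesis
    using gauss_mean_norm_pos[of n] by (simp add: sphere_mean_abs_dot_unit[OF n u(1)] ennreal_mult'[symmetric] mult.commute)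
qed

text \<open>
  For \<open>x, y \<noteq> 0\<close> this is \<open>\<bar>x\<bar> \<bar>y\<bar> t\<^sup>k\<^sup>+\<^sup>1\<close> with \<open>t\<close> the cosine of the angle between them; only odd \<open>k\<close> occur below,
  which makes the kernel nonnegative.
\<close>

definition even_kernel :: "nat \<Rightarrow> nat \<Rightarrow> (nat \<Rightarrow> real) \<Rightarrow> (nat \<Rightarrow> real) \<Rightarrow> real" where
  "even_kernel k n x y = dot n x y ^ (k + 1) / (nrm n x ^ k * nrm n y ^ k)"

text \<open>
  By homogeneity the unit vector case carries over, with the powers of the cosine multiplied by \<open>\<bar>x\<bar> \<bar>y\<bar>\<close>.
  If \<open>x\<close> or \<open>y\<close> vanishes, so do both sides.
\<close>

lemma sphere_kernel_bound:
  assumes n: "n \<ge> 2"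
  shows "sphere_kernel n x y \<le> ennreal (2 / (pi * real n) *
    (nrm n x * nrm n y + even_kernel 1 n x y / 2 + even_kernel 3 n x y / 24 + 24 * even_kernel 5 n x y))"
proof (cases "nrm n x = 0 \<or> nrm n y = 0")
  case True
  then have "sphere_kernel n x y = 0"
    by (auto simp: sphere_kernel_def dot_zero)
  then show ?thesis by simp
next
  case False
  then obtain u v where u: "nrm n u = 1" "\<And>z. dot n z x = nrm n x * dot n z u"
    and v: "nrm n v = 1" "\<And>z. dot n z y = nrm n y * dot n z v"
    by (metis unit_direction)
  define a b t where "a = nrm n x" and "b = nrm n y" and "t = dot n u v"
  have ab: "a > 0" "b > 0"
    using False L2_set_nonneg[of x "{..<n}"] L2_set_nonneg[of y "{..<n}"] by (simp_all add: a_def b_def less_le)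
  have dot: "dot n x y = a * b * t"
    using u(2)[of v] v(2)[of x] by (simp add: dot_commute a_def b_def t_def)
  have "sphere_kernel n x y = (\<integral>\<^sup>+\<theta>. ennreal (a * b) * ennreal (\<bar>dot n \<theta> u\<bar> * \<bar>dot n \<theta> v\<bar>) \<partial>sphere_measure n)"
    unfolding sphere_kernel_def
    by (intro nn_integral_cong, subst ennreal_mult'[symmetric]) (use ab in \<open>simp_all add: u(2) v(2) abs_mult a_def b_def mult_ac\<close>)
  also have "\<dots> = ennreal (a * b) * sphere_kernel n u v"
    unfolding sphere_kernel_def by (rule nn_integral_cmult) (rule measurable_sphere_measure, measurable)
  also have "\<dots> \<le> ennreal (a * b) * ennreal (2 / (pi * real n) * (1 + t\<^sup>2 / 2 + t ^ 4 / 24 + 24 * t ^ 6))"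
    using sphere_kernel_unit_bound[OF n u(1) v(1)] by (intro mult_left_mono) (auto simp: t_def)
  also have "\<dots> = ennreal (a * b * (2 / (pi * real n) * (1 + t\<^sup>2 / 2 + t ^ 4 / 24 + 24 * t ^ 6)))"
    using ab by (intro ennreal_mult'[symmetric]) simp
  also have "a * b * (2 / (pi * real n) * (1 + t\<^sup>2 / 2 + t ^ 4 / 24 + 24 * t ^ 6)) = 2 / (pi * real n) *
      (a * b + a * b * t\<^sup>2 / 2 + a * b * t ^ 4 / 24 + 24 * (a * b * t ^ 6))"
    by (simp add: algebra_simps)
  finally have "sphere_kernel n x y \<le> ennreal (2 / (pi * real n) *
      (a * b + a * b * t\<^sup>2 / 2 + a * b * t ^ 4 / 24 + 24 * (a * b * t ^ 6)))" .
  moreover have "a * b * t\<^sup>2 = even_kernel 1 n x y" "a * b * t ^ 4 = even_kernel 3 n x y" "a * b * t ^ 6 = even_kernel 5 n x y"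
    using ab by (simp_all add: even_kernel_def dot a_def[symmetric] b_def[symmetric] power_mult_distrib field_simps eval_nat_numeral)
  ultimately show ?thesis by (simp only: a_def b_def)
qed

section \<open>Averaging over the measure\<close>

text \<open>
  Kernels of linear growth in each variable are integrable against a measure with finite first moment,
  and their iterated integrals are linear in the kernel.
\<close>

definition dominated_kernel :: "nat \<Rightarrow> ((nat \<Rightarrow> real) \<Rightarrow> (nat \<Rightarrow> real) \<Rightarrow> real) \<Rightarrow> bool" where
  "dominated_kernel n q \<longleftrightarrow> (\<lambda>(x, y). q x y) \<in> borel_measurable (borel_Rn n \<Otimes>\<^sub>M borel_Rn n) \<and>
     (\<exists>c\<ge>0. \<forall>x y. \<bar>q x y\<bar> \<le> c * (nrm n x * nrm n y))"

lemma dominated_kernel_measurable: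
  assumes "dominated_kernel n q"
  shows "(\<lambda>(x, y). q x y) \<in> borel_measurable (borel_Rn n \<Otimes>\<^sub>M borel_Rn n)"
  using assms by (simp only: dominated_kernel_def)

lemma dominated_kernelE:
  assumes "dominated_kernel n q"
  obtains c where "c \<ge> 0" "\<And>x y. \<bar>q x y\<bar> \<le> c * (nrm n x * nrm n y)"
proof -
  have "\<exists>c. c \<ge> 0 \<and> (\<forall>x y. \<bar>q x y\<bar> \<le> c * (nrm n x * nrm n y))"
    using assms by (simp only: dominated_kernel_def)
  then obtain c where "c \<ge> 0 \<and> (\<forall>x y. \<bar>q x y\<bar> \<le> c * (nrm n x * nrm n y))" ..
  then show thesis by (intro that[of c]) simp_all
qed

locale finite_moment_prob =
  fixes n :: nat and \<mu> :: "(nat \<Rightarrow> real) measure"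
  assumes borel_prob: "borel_prob n \<mu>"
    and integrable_nrm: "integrable \<mu> (nrm n)"
begin

sublocale M: prob_space \<mu>
  using borel_prob by (simp add: borel_prob_def)

lemma sets_mu [measurable_cong]: "sets \<mu> = sets (borel_Rn n)"
  using borel_prob by (simp add: borel_prob_def)

lemma measurable_ident_mu: "(\<lambda>x. x) \<in> \<mu> \<rightarrow>\<^sub>M borel_Rn n"
  by (simp add: measurable_ident_sets sets_mu)

definition mean_norm :: real where "mean_norm = (\<integral>x. nrm n x \<partial>\<mu>)"

lemma mean_norm_nonneg: "mean_norm \<ge> 0"
  by (simp add: mean_norm_def)

definition mean_abs_dot :: "(nat \<Rightarrow> real) \<Rightarrow> real" where
  "mean_abs_dot \<theta> = (\<integral>x. \<bar>dot n \<theta> x\<bar> \<partial>\<mu>)"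

definition kernel_mean :: "((nat \<Rightarrow> real) \<Rightarrow> (nat \<Rightarrow> real) \<Rightarrow> real) \<Rightarrow> real" where
  "kernel_mean q = (\<integral>y. \<integral>x. q x y \<partial>\<mu> \<partial>\<mu>)"

lemma
  assumes "dominated_kernel n q"
  shows integrable_dominated_kernel: "y \<in> space \<mu> \<Longrightarrow> integrable \<mu> (\<lambda>x. q x y)"
    and integrable_dominated_kernel_integral: "integrable \<mu> (\<lambda>y. \<integral>x. q x y \<partial>\<mu>)"
proof -
  obtain c where c: "c \<ge> 0" "\<And>x y. \<bar>q x y\<bar> \<le> c * (nrm n x * nrm n y)"
    by (rule dominated_kernelE[OF assms]) (rule that)
  note q = dominated_kernel_measurable[OF assms]
  have q' [measurable]: "(\<lambda>p. q (f p) (g p)) \<in> borel_measurable N"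
    if [measurable]: "f \<in> N \<rightarrow>\<^sub>M borel_Rn n" "g \<in> N \<rightarrow>\<^sub>M borel_Rn n" for f g and N :: "'c measure"
    using measurable_compose[OF measurable_Pair[OF that] q] by simp
  have int: "integrable \<mu> (\<lambda>x. q x y)" if y: "y \<in> space \<mu>" for y
  proof (rule Bochner_Integration.integrable_bound)
    show "integrable \<mu> (\<lambda>x. c * (nrm n x * nrm n y))" using integrable_nrm by simp
    have "(\<lambda>_. y) \<in> \<mu> \<rightarrow>\<^sub>M borel_Rn n"
      using y sets_eq_imp_space_eq[OF sets_mu] by simp
    then show "(\<lambda>x. q x y) \<in> borel_measurable \<mu>"
      by (rule q'[OF measurable_ident_mu])
    show "AE x in \<mu>. norm (q x y) \<le> norm (c * (nrm n x * nrm n y))"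
      using c by (auto simp: abs_mult)
  qed
  show "y \<in> space \<mu> \<Longrightarrow> integrable \<mu> (\<lambda>x. q x y)" by (rule int)
  show "integrable \<mu> (\<lambda>y. \<integral>x. q x y \<partial>\<mu>)"
  proof (rule Bochner_Integration.integrable_bound)
    show "integrable \<mu> (\<lambda>y. c * mean_norm * nrm n y)" using integrable_nrm by simp
    show "(\<lambda>y. \<integral>x. q x y \<partial>\<mu>) \<in> borel_measurable \<mu>" by measurable
    show "AE y in \<mu>. norm (\<integral>x. q x y \<partial>\<mu>) \<le> norm (c * mean_norm * nrm n y)"
    proof (rule AE_I2)
      fix y assume y: "y \<in> space \<mu>"
      have "norm (\<integral>x. q x y \<partial>\<mu>) \<le> (\<integral>x. norm (q x y) \<partial>\<mu>)" by (rule integral_norm_bound)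
      also have "\<dots> \<le> (\<integral>x. c * (nrm n x * nrm n y) \<partial>\<mu>)"
        using int[OF y] integrable_nrm c(2) by (intro integral_mono) auto
      also have "\<dots> = c * mean_norm * nrm n y" by (simp add: mean_norm_def)
      finally show "norm (\<integral>x. q x y \<partial>\<mu>) \<le> norm (c * mean_norm * nrm n y)"
        using c(1) mean_norm_nonneg by simp
    qed
  qed
qed

lemma nn_integral_dominated_kernel:
  assumes "dominated_kernel n q" and "\<And>x y. q x y \<ge> 0"
  shows "(\<integral>\<^sup>+y. \<integral>\<^sup>+x. ennreal (q x y) \<partial>\<mu> \<partial>\<mu>) = ennreal (kernel_mean q)"
proof -
  have "(\<integral>\<^sup>+y. \<integral>\<^sup>+x. ennreal (q x y) \<partial>\<mu> \<partial>\<mu>) = (\<integral>\<^sup>+y. ennreal (\<integral>x. q x y \<partial>\<mu>) \<partial>\<mu>)"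
    using integrable_dominated_kernel[OF assms(1)] assms(2)
    by (intro nn_integral_cong nn_integral_eq_integral) auto
  also have "\<dots> = ennreal (kernel_mean q)"
    unfolding kernel_mean_def
    using integrable_dominated_kernel_integral[OF assms(1)] assms(2)
    by (intro nn_integral_eq_integral) auto
  finally show ?thesis .
qed

lemma dominated_kernel_add:
  assumes "dominated_kernel n p" "dominated_kernel n q"
  shows "dominated_kernel n (\<lambda>x y. p x y + q x y)"
    and kernel_mean_add: "kernel_mean (\<lambda>x y. p x y + q x y) = kernel_mean p + kernel_mean q"
proof -
  obtain c where c: "c \<ge> 0" "\<And>x y. \<bar>p x y\<bar> \<le> c * (nrm n x * nrm n y)"
    by (rule dominated_kernelE[OF assms(1)]) (rule that)
  note mp = dominated_kernel_measurable[OF assms(1)]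
  obtain d where d: "d \<ge> 0" "\<And>x y. \<bar>q x y\<bar> \<le> d * (nrm n x * nrm n y)"
    by (rule dominated_kernelE[OF assms(2)]) (rule that)
  note mq = dominated_kernel_measurable[OF assms(2)]
  have "\<bar>p x y + q x y\<bar> \<le> (c + d) * (nrm n x * nrm n y)" for x y
    using c(2)[of x y] d(2)[of x y] unfolding distrib_right by linarith
  moreover have "(\<lambda>(x, y). p x y + q x y) \<in> borel_measurable (borel_Rn n \<Otimes>\<^sub>M borel_Rn n)"
    using borel_measurable_add[OF mp mq] by (simp add: case_prod_beta')
  ultimately show "dominated_kernel n (\<lambda>x y. p x y + q x y)"
    using c(1) d(1) unfolding dominated_kernel_def by (intro conjI exI[of _ "c + d"]) auto
  have "kernel_mean (\<lambda>x y. p x y + q x y) = (\<integral>y. (\<integral>x. p x y \<partial>\<mu>) + (\<integral>x. q x y \<partial>\<mu>) \<partial>\<mu>)"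
    unfolding kernel_mean_def
    by (intro Bochner_Integration.integral_cong Bochner_Integration.integral_add integrable_dominated_kernel assms) auto
  also have "\<dots> = kernel_mean p + kernel_mean q"
    unfolding kernel_mean_def by (intro Bochner_Integration.integral_add integrable_dominated_kernel_integral assms)
  finally show "kernel_mean (\<lambda>x y. p x y + q x y) = kernel_mean p + kernel_mean q" .
qed

lemma dominated_kernel_cmult:
  assumes "dominated_kernel n p"
  shows "dominated_kernel n (\<lambda>x y. r * p x y)"
    and kernel_mean_cmult: "kernel_mean (\<lambda>x y. r * p x y) = r * kernel_mean p"
proof -
  obtain c where c: "c \<ge> 0" "\<And>x y. \<bar>p x y\<bar> \<le> c * (nrm n x * nrm n y)"
    by (rule dominated_kernelE[OF assms]) (rule that)
  note m = dominated_kernel_measurable[OF assms]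
  have "\<bar>r * p x y\<bar> \<le> (\<bar>r\<bar> * c) * (nrm n x * nrm n y)" for x y
    using mult_left_mono[OF c(2)[of x y], of "\<bar>r\<bar>"] by (simp add: abs_mult mult.assoc)
  moreover have "(\<lambda>(x, y). r * p x y) \<in> borel_measurable (borel_Rn n \<Otimes>\<^sub>M borel_Rn n)"
    using borel_measurable_times[OF borel_measurable_const m] by (simp add: case_prod_beta')
  ultimately show "dominated_kernel n (\<lambda>x y. r * p x y)"
    using c(1) unfolding dominated_kernel_def by (intro conjI exI[of _ "\<bar>r\<bar> * c"]) auto
  show "kernel_mean (\<lambda>x y. r * p x y) = r * kernel_mean p"
    by (simp add: kernel_mean_def)
qed

lemma dominated_kernel_norms: "dominated_kernel n (\<lambda>x y. nrm n x * nrm n y)"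
  unfolding dominated_kernel_def by (intro conjI exI[of _ 1]) (auto simp: abs_mult)

lemma kernel_mean_norms: "kernel_mean (\<lambda>x y. nrm n x * nrm n y) = mean_norm\<^sup>2"
  by (simp add: kernel_mean_def mean_norm_def power2_eq_square)

lemma dominated_kernel_even: "dominated_kernel n (even_kernel k n)"
proof -
  have "\<bar>even_kernel k n x y\<bar> \<le> 1 * (nrm n x * nrm n y)" for x y
  proof (cases "nrm n x * nrm n y = 0")
    case True
    have "dot n x y = 0" using abs_dot_le[of n x y] unfolding True by simp
    then show ?thesis by (simp add: even_kernel_def)
  next
    case False
    then have pos: "nrm n x * nrm n y > 0" by (simp add: less_le)
    have "\<bar>dot n x y\<bar> ^ (k + 1) \<le> (nrm n x * nrm n y) ^ (k + 1)"
      by (intro power_mono abs_dot_le) simp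
    then show ?thesis
      using pos by (simp add: even_kernel_def power_abs power_mult_distrib[symmetric] divide_le_eq abs_mult)
  qed
  moreover have "(\<lambda>p. even_kernel k n (fst p) (snd p)) \<in> borel_measurable (borel_Rn n \<Otimes>\<^sub>M borel_Rn n)"
    unfolding even_kernel_def by measurable
  ultimately show ?thesis
    unfolding dominated_kernel_def by (intro conjI exI[of _ 1]) (simp_all add: case_prod_beta')
qed

lemma integrable_abs_dot: "integrable \<mu> (\<lambda>x. \<bar>dot n \<theta> x\<bar>)"
proof (rule Bochner_Integration.integrable_bound)
  show "integrable \<mu> (\<lambda>x. nrm n \<theta> * nrm n x)" using integrable_nrm by simp
  show "(\<lambda>x. \<bar>dot n \<theta> x\<bar>) \<in> borel_measurable \<mu>"
    unfolding dot_commute[of n \<theta>] by measurable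
qed (use abs_dot_le[of n \<theta>] in auto)

lemma ennreal_mean_abs_dot: "ennreal (mean_abs_dot \<theta>) = (\<integral>\<^sup>+x. ennreal \<bar>dot n \<theta> x\<bar> \<partial>\<mu>)"
  unfolding mean_abs_dot_def by (rule nn_integral_eq_integral[OF integrable_abs_dot, symmetric]) simp

lemma mean_abs_dot_nonneg: "mean_abs_dot \<theta> \<ge> 0"
  by (simp add: mean_abs_dot_def)

lemma mean_abs_dot_le: "mean_abs_dot \<theta> \<le> nrm n \<theta> * mean_norm"
proof -
  have "mean_abs_dot \<theta> \<le> (\<integral>x. nrm n \<theta> * nrm n x \<partial>\<mu>)"
    unfolding mean_abs_dot_def using integrable_nrm
    by (intro integral_mono integrable_abs_dot abs_dot_le) simp
  then show ?thesis by (simp add: mean_norm_def)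
qed

lemma measurable_mean_abs_dot [measurable]: "mean_abs_dot \<in> borel_measurable (borel_Rn n)"
  unfolding mean_abs_dot_def by measurable

text \<open>
  Since \<open>t\<^sub>+ = (t + \<bar>t\<bar>) / 2\<close>, this is the point where centering is needed.
\<close>

lemma Fmu_eq_half_mean_abs_dot:
  assumes "centered n \<mu>"
  shows "Fmu n \<mu> \<theta> = mean_abs_dot \<theta> / 2"
proof -
  have int: "integrable \<mu> (\<lambda>x. x i)" if "i < n" for i
  proof (rule Bochner_Integration.integrable_bound[OF integrable_nrm])
    show "(\<lambda>x. x i) \<in> borel_measurable \<mu>"
      using measurable_component_borel_Rn[OF that] by (simp cong: measurable_cong_sets add: sets_mu)
    show "AE x in \<mu>. norm (x i) \<le> norm (nrm n x)"
      using abs_component_le_nrm[OF that] by (intro AE_I2) simp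
  qed
  have "(\<integral>x. dot n x \<theta> \<partial>\<mu>) = (\<Sum>i<n. (\<integral>x. x i \<partial>\<mu>) * \<theta> i)"
    unfolding dot_def using int by (subst Bochner_Integration.integral_sum) auto
  also have "\<dots> = 0" using assms by (simp add: centered_def)
  finally have zero: "(\<integral>x. dot n x \<theta> \<partial>\<mu>) = 0" .
  have int_dot: "integrable \<mu> (\<lambda>x. dot n x \<theta>)"
    unfolding dot_def using int by (intro Bochner_Integration.integrable_sum) auto
  have "Fmu n \<mu> \<theta> = (\<integral>x. (dot n x \<theta> + \<bar>dot n \<theta> x\<bar>) / 2 \<partial>\<mu>)"
    unfolding Fmu_def by (intro Bochner_Integration.integral_cong) (auto simp: max_def dot_commute[of n \<theta>])
  also have "\<dots> = ((\<integral>x. dot n x \<theta> \<partial>\<mu>) + mean_abs_dot \<theta>) / 2"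
    using int_dot integrable_abs_dot[of \<theta>] by (simp add: mean_abs_dot_def)
  finally show ?thesis by (simp add: zero)
qed

lemma integrable_mean_abs_dot_power:
  assumes n: "n \<ge> 1"
  shows "integrable (sphere_measure n) (\<lambda>\<theta>. mean_abs_dot \<theta> ^ k)"
proof -
  interpret S: prob_space "sphere_measure n" by (rule prob_space_sphere_measure[OF n])
  show ?thesis
  proof (rule S.integrable_const_bound)
    show "AE \<theta> in sphere_measure n. norm (mean_abs_dot \<theta> ^ k) \<le> mean_norm ^ k"
      using mean_abs_dot_le mean_abs_dot_nonneg
      by (intro AE_I2) (auto simp: space_sphere_measure unit_sphere_def power_abs intro!: power_mono, metis mult_1)
  qed (rule measurable_sphere_measure, measurable)
qed

lemma sphere_variance_Fmu:
  assumes n: "n \<ge> 1" and "centered n \<mu>"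
  shows "sphere_variance n (Fmu n \<mu>) =
    ((\<integral>\<theta>. (mean_abs_dot \<theta>)\<^sup>2 \<partial>sphere_measure n) - (\<integral>\<theta>. mean_abs_dot \<theta> \<partial>sphere_measure n)\<^sup>2) / 4"
proof -
  interpret S: prob_space "sphere_measure n" by (rule prob_space_sphere_measure[OF n])
  have F: "Fmu n \<mu> = (\<lambda>\<theta>. mean_abs_dot \<theta> / 2)"
    by (intro ext Fmu_eq_half_mean_abs_dot assms)
  show ?thesis
    unfolding sphere_variance_def F
    using integrable_mean_abs_dot_power[OF n, of 1] integrable_mean_abs_dot_power[OF n, of 2]
    by (subst S.variance_eq) (auto simp: power_divide diff_divide_distrib)
qed

lemma measurable_fst_sphere_mu: "fst \<in> sphere_measure n \<Otimes>\<^sub>M \<mu> \<rightarrow>\<^sub>M borel_Rn n"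
  by (rule measurable_compose[OF measurable_fst measurable_ident_sphere_measure])

lemma measurable_snd_sphere_mu: "snd \<in> sphere_measure n \<Otimes>\<^sub>M \<mu> \<rightarrow>\<^sub>M borel_Rn n"
  by (rule measurable_compose[OF measurable_snd measurable_ident_mu])

lemma measurable_abs_dot_pair:
  "(\<lambda>p. ennreal \<bar>dot n (fst p) (snd p)\<bar>) \<in> borel_measurable (sphere_measure n \<Otimes>\<^sub>M \<mu>)"
  by (intro measurable_compose[OF _ measurable_ennreal] borel_measurable_abs
      measurable_dot[OF measurable_fst_sphere_mu measurable_snd_sphere_mu])

lemma measurable_abs_dot_fst:
  "(\<lambda>p. ennreal \<bar>dot n (fst p) y\<bar>) \<in> borel_measurable (sphere_measure n \<Otimes>\<^sub>M \<mu>)"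
  by (intro measurable_compose[OF _ measurable_ennreal] borel_measurable_abs
      measurable_compose[OF measurable_fst_sphere_mu measurable_dot_const])

lemma measurable_mean_abs_dot_fst:
  "(\<lambda>p. ennreal (mean_abs_dot (fst p))) \<in> borel_measurable (sphere_measure n \<Otimes>\<^sub>M \<mu>)"
  by (intro measurable_compose[OF _ measurable_ennreal]
      measurable_compose[OF measurable_fst_sphere_mu measurable_mean_abs_dot])

lemma sphere_integral_mean_abs_dot:
  assumes n: "n \<ge> 1"
  shows "(\<integral>\<theta>. mean_abs_dot \<theta> \<partial>sphere_measure n) = sqrt (2 / pi) / gauss_mean_norm n * mean_norm"
proof -
  interpret S: prob_space "sphere_measure n" by (rule prob_space_sphere_measure[OF n])
  interpret P: pair_sigma_finite "sphere_measure n" \<mu> ..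
  have "ennreal (\<integral>\<theta>. mean_abs_dot \<theta> \<partial>sphere_measure n) = (\<integral>\<^sup>+\<theta>. ennreal (mean_abs_dot \<theta>) \<partial>sphere_measure n)"
    using integrable_mean_abs_dot_power[OF n, of 1] mean_abs_dot_nonneg
    by (intro nn_integral_eq_integral[symmetric]) auto
  also have "\<dots> = (\<integral>\<^sup>+\<theta>. \<integral>\<^sup>+x. ennreal \<bar>dot n \<theta> x\<bar> \<partial>\<mu> \<partial>sphere_measure n)"
    by (simp add: ennreal_mean_abs_dot)
  also have "\<dots> = (\<integral>\<^sup>+x. \<integral>\<^sup>+\<theta>. ennreal \<bar>dot n \<theta> x\<bar> \<partial>sphere_measure n \<partial>\<mu>)"
    using measurable_abs_dot_pair by (intro P.Fubini'[symmetric]) (simp add: case_prod_beta')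
  also have "\<dots> = (\<integral>\<^sup>+x. ennreal (sqrt (2 / pi) / gauss_mean_norm n * nrm n x) \<partial>\<mu>)"
    by (simp only: sphere_mean_abs_dot[OF n])
  also have "\<dots> = ennreal (\<integral>x. sqrt (2 / pi) / gauss_mean_norm n * nrm n x \<partial>\<mu>)"
    using integrable_nrm gauss_mean_norm_pos[of n] by (intro nn_integral_eq_integral) auto
  also have "(\<integral>x. sqrt (2 / pi) / gauss_mean_norm n * nrm n x \<partial>\<mu>) = sqrt (2 / pi) / gauss_mean_norm n * mean_norm"
    by (simp add: mean_norm_def)
  finally show ?thesis
    using mean_abs_dot_nonneg mean_norm_nonneg gauss_mean_norm_pos[of n]
    by (subst (asm) ennreal_inj) auto
qed

text \<open>
  The square of the \<open>\<mu>\<close>-integral is a double \<open>\<mu>\<close>-integral; exchanging it with the sphere integral leaves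
  \<open>sphere_kernel\<close> inside, and the pointwise bound for that kernel is integrated term by term.
\<close>

lemma sphere_integral_mean_abs_dot_square:
  assumes n: "n \<ge> 2"
  shows "(\<integral>\<theta>. (mean_abs_dot \<theta>)\<^sup>2 \<partial>sphere_measure n) \<le> 2 / (pi * real n) *
    (mean_norm\<^sup>2 + kernel_mean (even_kernel 1 n) / 2 + kernel_mean (even_kernel 3 n) / 24 + 24 * kernel_mean (even_kernel 5 n))"
proof -
  have n1: "n \<ge> 1" using n by simp
  interpret S: prob_space "sphere_measure n" by (rule prob_space_sphere_measure[OF n1])
  interpret P: pair_sigma_finite "sphere_measure n" \<mu> ..
  define Q where "Q = (\<lambda>x y. 2 / (pi * real n) * (nrm n x * nrm n y + 1 / 2 * even_kernel 1 n x y +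
    1 / 24 * even_kernel 3 n x y + 24 * even_kernel 5 n x y))"
  have even_nonneg: "even_kernel 1 n x y \<ge> 0" "even_kernel 3 n x y \<ge> 0" "even_kernel 5 n x y \<ge> 0" for x y
    unfolding even_kernel_def by (auto intro!: divide_nonneg_nonneg mult_nonneg_nonneg zero_le_even_power)
  have Q_nonneg: "Q x y \<ge> 0" for x y
    unfolding Q_def using even_nonneg[of x y] by (intro mult_nonneg_nonneg add_nonneg_nonneg) auto
  have Q_dom: "dominated_kernel n Q"
    unfolding Q_def
    by (intro dominated_kernel_add dominated_kernel_cmult dominated_kernel_even dominated_kernel_norms)
  have Q_mean: "kernel_mean Q = 2 / (pi * real n) *
      (mean_norm\<^sup>2 + kernel_mean (even_kernel 1 n) / 2 + kernel_mean (even_kernel 3 n) / 24 + 24 * kernel_mean (even_kernel 5 n))"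
    unfolding Q_def
    by (simp only: kernel_mean_add kernel_mean_cmult kernel_mean_norms dominated_kernel_add dominated_kernel_cmult
        dominated_kernel_even dominated_kernel_norms) simp
  have "ennreal (\<integral>\<theta>. (mean_abs_dot \<theta>)\<^sup>2 \<partial>sphere_measure n) = (\<integral>\<^sup>+\<theta>. ennreal ((mean_abs_dot \<theta>)\<^sup>2) \<partial>sphere_measure n)"
    using integrable_mean_abs_dot_power[OF n1, of 2]
    by (intro nn_integral_eq_integral[symmetric]) auto
  also have "\<dots> = (\<integral>\<^sup>+\<theta>. \<integral>\<^sup>+y. ennreal (mean_abs_dot \<theta>) * ennreal \<bar>dot n \<theta> y\<bar> \<partial>\<mu> \<partial>sphere_measure n)"
  proof (rule nn_integral_cong)
    fix \<theta>
    have "(\<lambda>x. ennreal \<bar>dot n \<theta> x\<bar>) \<in> borel_measurable \<mu>"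
      using borel_measurable_integrable[OF integrable_abs_dot] by measurable
    then have "(\<integral>\<^sup>+y. ennreal (mean_abs_dot \<theta>) * ennreal \<bar>dot n \<theta> y\<bar> \<partial>\<mu>) = ennreal (mean_abs_dot \<theta>) * ennreal (mean_abs_dot \<theta>)"
      unfolding ennreal_mean_abs_dot[of \<theta>] by (rule nn_integral_cmult)
    then show "ennreal ((mean_abs_dot \<theta>)\<^sup>2) = (\<integral>\<^sup>+y. ennreal (mean_abs_dot \<theta>) * ennreal \<bar>dot n \<theta> y\<bar> \<partial>\<mu>)"
      using mean_abs_dot_nonneg[of \<theta>] by (simp add: power2_eq_square ennreal_mult')
  qed
  also have "\<dots> = (\<integral>\<^sup>+y. \<integral>\<^sup>+\<theta>. ennreal (mean_abs_dot \<theta>) * ennreal \<bar>dot n \<theta> y\<bar> \<partial>sphere_measure n \<partial>\<mu>)"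
    using borel_measurable_times_ennreal[OF measurable_mean_abs_dot_fst measurable_abs_dot_pair]
    by (intro P.Fubini'[symmetric]) (simp add: case_prod_beta')
  also have "\<dots> = (\<integral>\<^sup>+y. \<integral>\<^sup>+x. sphere_kernel n x y \<partial>\<mu> \<partial>\<mu>)"
  proof (rule nn_integral_cong)
    fix y
    have "(\<integral>\<^sup>+\<theta>. ennreal (mean_abs_dot \<theta>) * ennreal \<bar>dot n \<theta> y\<bar> \<partial>sphere_measure n) =
        (\<integral>\<^sup>+\<theta>. \<integral>\<^sup>+x. ennreal \<bar>dot n \<theta> x\<bar> * ennreal \<bar>dot n \<theta> y\<bar> \<partial>\<mu> \<partial>sphere_measure n)"
    proof (rule nn_integral_cong)
      fix \<theta>
      have "(\<lambda>x. ennreal \<bar>dot n \<theta> x\<bar>) \<in> borel_measurable \<mu>"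
        using borel_measurable_integrable[OF integrable_abs_dot] by measurable
      then show "ennreal (mean_abs_dot \<theta>) * ennreal \<bar>dot n \<theta> y\<bar> =
          (\<integral>\<^sup>+x. ennreal \<bar>dot n \<theta> x\<bar> * ennreal \<bar>dot n \<theta> y\<bar> \<partial>\<mu>)"
        unfolding ennreal_mean_abs_dot by (rule nn_integral_multc[symmetric])
    qed
    also have "\<dots> = (\<integral>\<^sup>+x. \<integral>\<^sup>+\<theta>. ennreal \<bar>dot n \<theta> x\<bar> * ennreal \<bar>dot n \<theta> y\<bar> \<partial>sphere_measure n \<partial>\<mu>)"
      using borel_measurable_times_ennreal[OF measurable_abs_dot_pair measurable_abs_dot_fst]
      by (intro P.Fubini'[symmetric]) (simp add: case_prod_beta')
    also have "\<dots> = (\<integral>\<^sup>+x. sphere_kernel n x y \<partial>\<mu>)"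
      unfolding sphere_kernel_def by (simp add: ennreal_mult')
    finally show "(\<integral>\<^sup>+\<theta>. ennreal (mean_abs_dot \<theta>) * ennreal \<bar>dot n \<theta> y\<bar> \<partial>sphere_measure n) =
        (\<integral>\<^sup>+x. sphere_kernel n x y \<partial>\<mu>)" .
  qed
  also have "\<dots> \<le> (\<integral>\<^sup>+y. \<integral>\<^sup>+x. ennreal (Q x y) \<partial>\<mu> \<partial>\<mu>)"
    using sphere_kernel_bound[OF n] by (intro nn_integral_mono) (simp add: Q_def)
  also have "\<dots> = ennreal (kernel_mean Q)"
    by (rule nn_integral_dominated_kernel[OF Q_dom Q_nonneg])
  finally show ?thesis
    unfolding Q_mean[symmetric]
  proof (subst (asm) ennreal_le_iff)
    show "kernel_mean Q \<ge> 0"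
      unfolding kernel_mean_def by (intro Bochner_Integration.integral_nonneg Q_nonneg)
  qed
qed

lemma integrable_Cov1:
  assumes "i < n" "j < n"
  shows "integrable \<mu> (\<lambda>x. x i * x j / nrm n x)"
proof (rule Bochner_Integration.integrable_bound[OF integrable_nrm])
  have [measurable]: "(\<lambda>x. x i) \<in> borel_measurable \<mu>" "(\<lambda>x. x j) \<in> borel_measurable \<mu>"
    using measurable_component_borel_Rn assms by (simp_all cong: measurable_cong_sets add: sets_mu)
  show "(\<lambda>x. x i * x j / nrm n x) \<in> borel_measurable \<mu>" by measurable
  show "AE x in \<mu>. norm (x i * x j / nrm n x) \<le> norm (nrm n x)"
  proof (rule AE_I2)
    fix x
    have "\<bar>x i\<bar> * \<bar>x j\<bar> \<le> nrm n x * nrm n x"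
      using assms by (intro mult_mono abs_component_le_nrm) auto
    then show "norm (x i * x j / nrm n x) \<le> norm (nrm n x)"
      by (cases "nrm n x = 0") (simp_all add: abs_mult divide_le_eq less_le)
  qed
qed

text \<open>
  The trace of \<open>Cov\<^sub>1(\<mu>)\<close> is \<open>\<integral> \<bar>x\<bar> d\<mu>\<close>. The mean of \<open>(x \<cdot> y)\<^sup>2 / (\<bar>x\<bar> \<bar>y\<bar>)\<close> is the squared Hilbert-Schmidt norm of
  \<open>Cov\<^sub>1(\<mu>)\<close>; for a multiple \<open>c\<close> of the identity one of the two integrations already gives \<open>c \<bar>y\<bar>\<close>.
\<close>

lemma
  assumes Cov1: "\<And>i j. i < n \<Longrightarrow> j < n \<Longrightarrow> Cov1 n \<mu> i j = (if i = j then c else 0)"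
  shows mean_norm_isotropic: "mean_norm = real n * c"
    and kernel_mean_1_isotropic: "kernel_mean (even_kernel 1 n) = c * mean_norm"
proof -
  have delta: "(\<Sum>j<n. (if i = j then c else 0) * g j) = c * g i" if "i < n" for i and g :: "nat \<Rightarrow> real"
    using that by (simp add: if_distrib[of "\<lambda>t. t * _"] cong: if_cong)
  have nrm_sum: "nrm n x = (\<Sum>i<n. x i * x i / nrm n x)" for x
    using dot_self[of n x] by (simp add: dot_def sum_divide_distrib[symmetric] power2_eq_square)
  have "mean_norm = (\<integral>x. (\<Sum>i<n. x i * x i / nrm n x) \<partial>\<mu>)"
    unfolding mean_norm_def by (subst nrm_sum) simp
  also have "\<dots> = (\<Sum>i<n. Cov1 n \<mu> i i)"
    unfolding Cov1_def by (intro Bochner_Integration.integral_sum integrable_Cov1) auto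
  finally show mean: "mean_norm = real n * c" by (simp add: Cov1)
  have inner: "(\<integral>x. even_kernel 1 n x y \<partial>\<mu>) = c * nrm n y" for y
  proof -
    have "even_kernel 1 n x y = (\<Sum>i<n. \<Sum>j<n. x i * x j / nrm n x * (y i * y j / nrm n y))" for x
      by (simp add: even_kernel_def dot_def power2_eq_square sum_product sum_divide_distrib mult_ac)
    then have "(\<integral>x. even_kernel 1 n x y \<partial>\<mu>) = (\<integral>x. (\<Sum>i<n. \<Sum>j<n. x i * x j / nrm n x * (y i * y j / nrm n y)) \<partial>\<mu>)"
      by simp
    also have "\<dots> = (\<Sum>i<n. \<integral>x. (\<Sum>j<n. x i * x j / nrm n x * (y i * y j / nrm n y)) \<partial>\<mu>)"
      by (intro Bochner_Integration.integral_sum Bochner_Integration.integrable_sum integrable_mult_left integrable_Cov1) auto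
    also have "\<dots> = (\<Sum>i<n. \<Sum>j<n. Cov1 n \<mu> i j * (y i * y j / nrm n y))"
      unfolding Cov1_def integral_mult_left_zero[symmetric]
      by (intro sum.cong refl Bochner_Integration.integral_sum integrable_mult_left integrable_Cov1) auto
    also have "\<dots> = (\<Sum>i<n. \<Sum>j<n. (if i = j then c else 0) * (y i * y j / nrm n y))"
      by (intro sum.cong refl) (simp add: Cov1)
    also have "\<dots> = (\<Sum>i<n. c * (y i * y i / nrm n y))"
    proof (intro sum.cong refl)
      fix i assume "i \<in> {..<n}"
      then show "(\<Sum>j<n. (if i = j then c else 0) * (y i * y j / nrm n y)) = c * (y i * y i / nrm n y)"
        using delta[of i "\<lambda>j. y i * y j / nrm n y"] by simp
    qed
    also have "\<dots> = c * nrm n y"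
      by (subst (2) nrm_sum) (simp add: sum_distrib_left)
    finally show ?thesis .
  qed
  show "kernel_mean (even_kernel 1 n) = c * mean_norm"
    unfolding kernel_mean_def inner mean_norm_def by simp
qed

section \<open>The variance bound\<close>

lemma sphere_variance_le_mean_norm:
  assumes n: "n \<ge> 1" and "centered n \<mu>"
  shows "sphere_variance n (Fmu n \<mu>) \<le> mean_norm\<^sup>2 / 4"
proof -
  interpret S: prob_space "sphere_measure n" by (rule prob_space_sphere_measure[OF n])
  have "(\<integral>\<theta>. (mean_abs_dot \<theta>)\<^sup>2 \<partial>sphere_measure n) \<le> (\<integral>\<theta>. mean_norm\<^sup>2 \<partial>sphere_measure n)"
  proof (rule integral_mono)
    fix \<theta> assume "\<theta> \<in> space (sphere_measure n)"
    then show "(mean_abs_dot \<theta>)\<^sup>2 \<le> mean_norm\<^sup>2"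
      using mean_abs_dot_le[of \<theta>] mean_abs_dot_nonneg[of \<theta>]
      by (intro power_mono) (simp_all add: space_sphere_measure unit_sphere_def)
  qed (use integrable_mean_abs_dot_power[OF n, of 2] in auto)
  also have "\<dots> = mean_norm\<^sup>2" by (simp add: S.prob_space)
  finally have "(\<integral>\<theta>. (mean_abs_dot \<theta>)\<^sup>2 \<partial>sphere_measure n) - (\<integral>\<theta>. mean_abs_dot \<theta> \<partial>sphere_measure n)\<^sup>2 \<le> mean_norm\<^sup>2"
    using zero_le_power2[of "\<integral>\<theta>. mean_abs_dot \<theta> \<partial>sphere_measure n"] by linarith
  then show ?thesis unfolding sphere_variance_Fmu[OF assms] by simp
qed

text \<open>
  The second moment and the squared mean have the same terms of degree \<open>0\<close> and \<open>2\<close>. The term with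
  \<open>8 n\<^sup>2\<close> is the part of the squared mean that offsets the fourth moment.
\<close>

lemma sphere_variance_isotropic_bound:
  assumes n: "n \<ge> 2" and "centered n \<mu>"
    and Cov1: "\<And>i j. i < n \<Longrightarrow> j < n \<Longrightarrow> Cov1 n \<mu> i j = (if i = j then c else 0)"
  shows "sphere_variance n (Fmu n \<mu>) \<le> 1 / (2 * pi * real n) *
    (kernel_mean (even_kernel 3 n) / 24 - mean_norm\<^sup>2 / (8 * (real n)\<^sup>2) +
      24 * kernel_mean (even_kernel 5 n) + mean_norm\<^sup>2 / real n ^ 3)"
proof -
  have n1: "n \<ge> 1" using n by simp
  have quarter: "A / 4 \<le> T" if "A \<le> 4 * T" for A T :: real
    using that by simp
  define a m x where "a = mean_norm" and "m = gauss_mean_norm n" and "x = real n"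
  have x: "x \<ge> 2" using n by (simp add: x_def)
  have m: "m > 0" by (simp add: m_def gauss_mean_norm_pos)
  define L where "L = x + 1/2 + 1 / (8 * x) - 1 / x\<^sup>2"
  define b where "b = x - 1/2 + 1 / (8 * (x - 1))"
  have mb: "m\<^sup>2 \<le> b"
    using gauss_mean_norm_upper_bound[OF n] by (simp add: m_def b_def x_def)
  have Lb: "L * b \<le> x\<^sup>2"
    using inverse_ratio_bound[OF n] by (simp add: L_def b_def x_def)
  have b: "b > 0" using mb m zero_less_power[of m 2] by linarith
  have "L \<le> x\<^sup>2 / b" using Lb b by (simp add: le_divide_eq)
  also have "\<dots> \<le> x\<^sup>2 / m\<^sup>2" using mb m b by (intro divide_left_mono) auto
  finally have Lm: "L \<le> x\<^sup>2 / m\<^sup>2" .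
  have "c = a / x" using mean_norm_isotropic[OF Cov1] x by (simp add: a_def x_def)
  then have k1: "kernel_mean (even_kernel 1 n) = a\<^sup>2 / x"
    using kernel_mean_1_isotropic[OF Cov1] by (simp add: a_def power2_eq_square)
  have second: "(\<integral>\<theta>. (mean_abs_dot \<theta>)\<^sup>2 \<partial>sphere_measure n) \<le> 2 / (pi * x) *
      (a\<^sup>2 + a\<^sup>2 / x / 2 + kernel_mean (even_kernel 3 n) / 24 + 24 * kernel_mean (even_kernel 5 n))"
    using sphere_integral_mean_abs_dot_square[OF n] unfolding k1 by (simp only: a_def x_def)
  have "2 / (pi * x) * (a\<^sup>2 + a\<^sup>2 / x / 2 + a\<^sup>2 / (8 * x\<^sup>2) - a\<^sup>2 / x ^ 3) = 2 / pi * (a\<^sup>2 / x\<^sup>2) * L"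
    using x by (simp add: L_def field_simps power2_eq_square power3_eq_cube)
  also have "\<dots> \<le> 2 / pi * (a\<^sup>2 / x\<^sup>2) * (x\<^sup>2 / m\<^sup>2)"
    using Lm by (intro mult_left_mono) auto
  also have "\<dots> = (sqrt (2 / pi) / m * a)\<^sup>2"
    using x by (simp add: power_mult_distrib power_divide)
  also have "\<dots> = (\<integral>\<theta>. mean_abs_dot \<theta> \<partial>sphere_measure n)\<^sup>2"
    by (simp add: sphere_integral_mean_abs_dot[OF n1] m_def a_def)
  finally have "(\<integral>\<theta>. (mean_abs_dot \<theta>)\<^sup>2 \<partial>sphere_measure n) - (\<integral>\<theta>. mean_abs_dot \<theta> \<partial>sphere_measure n)\<^sup>2 \<le>
      2 / (pi * x) * (a\<^sup>2 + a\<^sup>2 / x / 2 + kernel_mean (even_kernel 3 n) / 24 + 24 * kernel_mean (even_kernel 5 n)) -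
      2 / (pi * x) * (a\<^sup>2 + a\<^sup>2 / x / 2 + a\<^sup>2 / (8 * x\<^sup>2) - a\<^sup>2 / x ^ 3)"
    using second by linarith
  also have "\<dots> = 4 * (1 / (2 * pi * x) *
      (kernel_mean (even_kernel 3 n) / 24 - a\<^sup>2 / (8 * x\<^sup>2) + 24 * kernel_mean (even_kernel 5 n) + a\<^sup>2 / x ^ 3))"
  proof -
    have "2 / (pi * x) * u = 4 * (1 / (2 * pi * x) * v)" if "u = v" for u v
      by (simp add: that)
    then show ?thesis unfolding right_diff_distrib[symmetric] by this simp
  qed
  finally show ?thesis
    unfolding sphere_variance_Fmu[OF n1 assms(2)] a_def x_def by (rule quarter)
qed

end

theorem theorem2:
  shows "\<exists>C::real. C > 0 \<and>
    (\<forall>n::nat. n \<ge> 1 \<longrightarrow>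
      (\<forall>\<mu> \<alpha> \<beta> \<gamma> \<delta>.
         borel_prob n \<mu> \<longrightarrow> centered n \<mu> \<longrightarrow>
         \<alpha> > 0 \<longrightarrow> \<beta> > 0 \<longrightarrow> \<gamma> > 0 \<longrightarrow> \<delta> > 0 \<longrightarrow>
         (\<forall>i<n. \<forall>j<n. Cov1 n \<mu> i j = (if i = j then \<alpha> / sqrt (real n) else 0)) \<longrightarrow>
         (\<integral>y. (\<integral>x. dot n x y ^ 4 / (nrm n x ^ 3 * nrm n y ^ 3) \<partial>\<mu>) \<partial>\<mu>) \<le> \<beta> * \<alpha>\<^sup>2 / real n \<longrightarrow>
         \<beta> \<le> 3 + \<gamma> / real n \<longrightarrow>
         (\<integral>y. (\<integral>x. dot n x y ^ 6 / (nrm n x ^ 5 * nrm n y ^ 5) \<partial>\<mu>) \<partial>\<mu>) \<le> \<delta> * \<alpha>\<^sup>2 / (real n)\<^sup>2 \<longrightarrow>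
         sphere_variance n (Fmu n \<mu>) \<le> C * (1 + \<gamma> + \<delta>) * \<alpha>\<^sup>2 / real n ^ 3))"
proof (intro exI[of _ 24] conjI allI impI)
  fix n :: nat and \<mu> :: "(nat \<Rightarrow> real) measure" and \<alpha> \<beta> \<gamma> \<delta> :: real
  assume n: "n \<ge> 1" and mu: "borel_prob n \<mu>" and cen: "centered n \<mu>"
    and pos: "\<alpha> > 0" "\<beta> > 0" "\<gamma> > 0" "\<delta> > 0"
    and Cov: "\<forall>i<n. \<forall>j<n. Cov1 n \<mu> i j = (if i = j then \<alpha> / sqrt (real n) else 0)"
    and fourth: "(\<integral>y. (\<integral>x. dot n x y ^ 4 / (nrm n x ^ 3 * nrm n y ^ 3) \<partial>\<mu>) \<partial>\<mu>) \<le> \<beta> * \<alpha>\<^sup>2 / real n"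
    and beta: "\<beta> \<le> 3 + \<gamma> / real n"
    and sixth: "(\<integral>y. (\<integral>x. dot n x y ^ 6 / (nrm n x ^ 5 * nrm n y ^ 5) \<partial>\<mu>) \<partial>\<mu>) \<le> \<delta> * \<alpha>\<^sup>2 / (real n)\<^sup>2"
  interpret finite_moment_prob n \<mu>
    using mu cen by unfold_locales (simp_all add: centered_def)
  have Cov1: "Cov1 n \<mu> i j = (if i = j then \<alpha> / sqrt (real n) else 0)" if "i < n" "j < n" for i j
    using Cov that by blast
  define x where "x = real n"
  have x: "x \<ge> 1" using n by (simp add: x_def)
  have "mean_norm = x * (\<alpha> / sqrt x)"
    using mean_norm_isotropic[OF Cov1] by (simp add: x_def)
  then have "mean_norm\<^sup>2 = x\<^sup>2 * (\<alpha>\<^sup>2 / x)"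
    using x by (simp add: power_mult_distrib power_divide)
  then have mean: "mean_norm\<^sup>2 = \<alpha>\<^sup>2 * x"
    using x by (simp add: power2_eq_square)
  show "sphere_variance n (Fmu n \<mu>) \<le> 24 * (1 + \<gamma> + \<delta>) * \<alpha>\<^sup>2 / real n ^ 3"
  proof (cases "n = 1")
    case True
    have "sphere_variance n (Fmu n \<mu>) \<le> 1 / 4 * \<alpha>\<^sup>2"
      using sphere_variance_le_mean_norm[OF n cen] mean True by (simp add: x_def)
    also have "\<dots> \<le> 24 * (1 + \<gamma> + \<delta>) * \<alpha>\<^sup>2"
      using pos by (intro mult_right_mono) auto
    finally show ?thesis using True by simp
  next
    case False
    then have n2: "n \<ge> 2" using n by simp
    \<comment> \<open>The value \<open>3\<close> contributes \<open>3 / 24 = 1 / 8\<close>, which cancels against \<open>mean_norm\<^sup>2 / (8 x\<^sup>2) = \<alpha>\<^sup>2 / (8 x)\<close>.\<close>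
    have k3: "kernel_mean (even_kernel 3 n) \<le> \<beta> * \<alpha>\<^sup>2 / x"
      using fourth by (simp add: kernel_mean_def even_kernel_def x_def)
    also have "\<dots> \<le> (3 + \<gamma> / x) * \<alpha>\<^sup>2 / x"
      using beta x by (intro divide_right_mono mult_right_mono) (auto simp: x_def)
    finally have "kernel_mean (even_kernel 3 n) / 24 - mean_norm\<^sup>2 / (8 * x\<^sup>2) \<le>
        (3 + \<gamma> / x) * \<alpha>\<^sup>2 / x / 24 - \<alpha>\<^sup>2 * x / (8 * x\<^sup>2)"
      by (simp add: mean)
    also have "\<dots> = \<gamma> / 24 * (\<alpha>\<^sup>2 / x\<^sup>2)"
      using x by (simp add: field_simps power2_eq_square)
    finally have i1: "kernel_mean (even_kernel 3 n) / 24 - mean_norm\<^sup>2 / (8 * x\<^sup>2) \<le> \<gamma> / 24 * (\<alpha>\<^sup>2 / x\<^sup>2)" .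
    have i2: "24 * kernel_mean (even_kernel 5 n) \<le> 24 * \<delta> * (\<alpha>\<^sup>2 / x\<^sup>2)"
      using sixth by (simp add: kernel_mean_def even_kernel_def x_def)
    have i3: "mean_norm\<^sup>2 / x ^ 3 = \<alpha>\<^sup>2 / x\<^sup>2"
      unfolding mean using x by (simp add: power2_eq_square power3_eq_cube)
    have "sphere_variance n (Fmu n \<mu>) \<le> 1 / (2 * pi * x) * (kernel_mean (even_kernel 3 n) / 24 -
        mean_norm\<^sup>2 / (8 * x\<^sup>2) + 24 * kernel_mean (even_kernel 5 n) + mean_norm\<^sup>2 / x ^ 3)"
      unfolding x_def by (rule sphere_variance_isotropic_bound[OF n2 cen Cov1])
    also have "\<dots> \<le> 1 / (2 * pi * x) * (\<gamma> / 24 * (\<alpha>\<^sup>2 / x\<^sup>2) + 24 * \<delta> * (\<alpha>\<^sup>2 / x\<^sup>2) + \<alpha>\<^sup>2 / x\<^sup>2)"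
      unfolding i3 using x by (intro mult_left_mono add_mono i1 i2) auto
    also have "\<dots> = 1 / (2 * pi * x) * ((\<gamma> / 24 + 24 * \<delta> + 1) * (\<alpha>\<^sup>2 / x\<^sup>2))"
      by (simp only: distrib_right mult_1)
    also have "\<dots> \<le> 1 / x * (24 * (1 + \<gamma> + \<delta>) * (\<alpha>\<^sup>2 / x\<^sup>2))"
    proof (intro mult_mono mult_right_mono)
      have "1 \<le> 2 * pi" using pi_ge_two by simp
      then show "1 / (2 * pi * x) \<le> 1 / x" using x by (intro divide_left_mono) auto
    qed (use pos x in auto)
    also have "\<dots> = 24 * (1 + \<gamma> + \<delta>) * \<alpha>\<^sup>2 / x ^ 3"
      using x by (simp add: power2_eq_square power3_eq_cube)
    finally show ?thesis by (simp add: x_def)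
  qed
qed simp

end
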